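(* Let $f:\mathbb{R}^d\to\mathbb{R}$ be convex and twice continuously differentiable, bounded from below with bounded level-sets, and suppose $\nabla^2 f$ is $L_2$-Lipschitz, i.e. $\|\nabla^2 f(\mathbf{x})-\nabla^2 f(\mathbf{y})\|\le L_2\|\mathbf{x}-\mathbf{y}\|$ for all $\mathbf{x},\mathbf{y}\in\mathbb{R}^d$. Moreover, assume that $f$ is $\mu$-strongly convex with $\mu>0$, i.e. $\nabla^2 f(\mathbf{x})\succeq\mu\mathbf{I}$ for all $\mathbf{x}\in\mathbb{R}^d$. Let $\{\mathbf{x}_k\}_{k\ge0}$ be the sequence generated from $\mathbf{x}_0\in\mathbb{R}^d$ by the Krylov cubic regularized Newton method with subspace dimension $m\ge1$ and regularization parameter $M>0$, $M\ge L_2$. Let $\mathbf{x}^*$ be the minimizer of $f$ and $\delta_k:=f(\mathbf{x}_k)-f(\mathbf{x}^* )$. Then, for a target accuracy $\epsilon>0$, the number of iterations required to reach $\delta_k\le\epsilon$ can be upper bounded by $$k=\mathcal{O}\left(\left(\frac{\rho^{(m)}_{\max}}{m\mu}+1\right)\log\frac{\delta_0}{\epsilon}+\frac{\sqrt{L_2+M}\,\delta_0^{0.25}}{\mu^{0.75}}\right),$$ where $\rho^{(m)}_{\max}=\max_{i\in\{0,1,\dots,k-1\}}\rho^{(m)}(\nabla^2 f(\mathbf{x}_i),\nabla f(\mathbf{x}_i))$ and $\mathcal{O}(\cdot)$ hides an absolute numerical constant.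
   Context: Vector norms are Euclidean and matrix norms are operator norms. For a symmetric matrix $\mathbf{A}\in\mathbb{R}^{d\times d}$ and $\mathbf{b}\in\mathbb{R}^d$, the $j$-th Krylov subspace is $\mathcal{K}_j(\mathbf{A},\mathbf{b})=\mathrm{span}\{\mathbf{b},\mathbf{A}\mathbf{b},\dots,\mathbf{A}^{j-1}\mathbf{b}\}$. Krylov cubic regularized Newton method: with $\mathbf{g}_k=\nabla f(\mathbf{x}_k)$ and $\mathbf{H}_k=\nabla^2 f(\mathbf{x}_k)$, $$\mathbf{s}_k=\operatorname*{arg\,min}_{\mathbf{s}\in\mathcal{K}_m(\mathbf{H}_k,\mathbf{g}_k)}\Big\{\mathbf{g}_k^\top\mathbf{s}+\tfrac12\mathbf{s}^\top\mathbf{H}_k\mathbf{s}+\tfrac M6\|\mathbf{s}\|^3\Big\},\qquad \mathbf{x}_{k+1}=\mathbf{x}_k+\mathbf{s}_k .$$ (This is equivalent to minimizing over coordinates with respect to an orthonormal basis of the Krylov subspace.) For $j\ge1$ define $$\sigma^{(j)}(\mathbf{A},\mathbf{b})=\max_{\mathbf{w}\in\mathcal{K}_j(\mathbf{A},\mathbf{b}),\ \|\mathbf{w}\|=1}\mathrm{dist}\big(\mathbf{A}\mathbf{w},\mathcal{K}_j(\mathbf{A},\mathbf{b})\big),\qquad \mathrm{dist}(\mathbf{u},\mathcal{V})=\min_{\mathbf{v}\in\mathcal{V}}\|\mathbf{u}-\mathbf{v}\|,$$ and $\rho^{(m)}(\mathbf{A},\mathbf{b})=\big(\prod_{j=1}^m\sigma^{(j)}(\mathbf{A},\mathbf{b})\big)^{1/m}$.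 Convention: if $\mathbf{b}=0$ (so the Krylov subspace is $\{0\}$) then $\sigma^{(j)}(\mathbf{A},\mathbf{b})=0$.
   Formalization: The iteration bound is proved rounded up to an integer and only when at least one iteration is needed (ε < δ_0); unrounded it fails, e.g. for f = μx²/2 on the line with L_2 = 0 as M → 0 and ε → δ_0, and with no iterations the maximum defining ρ_max is over an empty set. *)

theory Defs
  imports "HOL-Analysis.Analysis"
begin

text \<open>
  An absolute constant must not depend on the dimension, so the dimension \<open>d\<close> has to be
  quantified inside the scope of that constant and cannot be a type.  All spaces \<open>\<real>\<^sup>d\<close> are
  therefore realised inside one inner product space, the finitely supported real sequences:
  \<open>Rn d\<close> consists of the sequences supported on the indices \<open>0, \<dots>, d - 1\<close>, with the
  Euclidean inner product, norm and topology.
\<close>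

typedef fsvec = "{x :: nat \<Rightarrow> real. finite {i. x i \<noteq> 0}}"
  morphisms coord Abs_fsvec
  by (rule exI[of _ "\<lambda>_. 0"]) simp

setup_lifting type_definition_fsvec

lemma finite_supp [simp]: "finite {i. coord x i \<noteq> 0}"
  using coord[of x] by simp

lemma fsvec_eqI: "(\<And>i. coord x i = coord y i) \<Longrightarrow> x = y"
  by (simp add: coord_inject[symmetric] ext)

instantiation fsvec :: real_vector
begin

lift_definition zero_fsvec :: fsvec is "\<lambda>_. 0" by simp

lift_definition plus_fsvec :: "fsvec \<Rightarrow> fsvec \<Rightarrow> fsvec" is "\<lambda>x y i. x i + y i"
proof -
  fix x y :: "nat \<Rightarrow> real"
  assume "finite {i. x i \<noteq> 0}" "finite {i. y i \<noteq> 0}"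
  then have "finite ({i. x i \<noteq> 0} \<union> {i. y i \<noteq> 0})" by simp
  then show "finite {i. x i + y i \<noteq> 0}" by (rule rev_finite_subset) auto
qed

lift_definition minus_fsvec :: "fsvec \<Rightarrow> fsvec \<Rightarrow> fsvec" is "\<lambda>x y i. x i - y i"
proof -
  fix x y :: "nat \<Rightarrow> real"
  assume "finite {i. x i \<noteq> 0}" "finite {i. y i \<noteq> 0}"
  then have "finite ({i. x i \<noteq> 0} \<union> {i. y i \<noteq> 0})" by simp
  then show "finite {i. x i - y i \<noteq> 0}" by (rule rev_finite_subset) auto
qed

lift_definition uminus_fsvec :: "fsvec \<Rightarrow> fsvec" is "\<lambda>x i. - x i" by simp

lift_definition scaleR_fsvec :: "real \<Rightarrow> fsvec \<Rightarrow> fsvec" is "\<lambda>c x i. c * x i"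
  by (erule rev_finite_subset) auto

instance
  by standard (transfer; simp add: fun_eq_iff algebra_simps)+

end

instantiation fsvec :: real_inner
begin

definition inner_fsvec :: "fsvec \<Rightarrow> fsvec \<Rightarrow> real"
  where "inner_fsvec x y = (\<Sum>i | coord x i \<noteq> 0. coord x i * coord y i)"

definition norm_fsvec :: "fsvec \<Rightarrow> real"
  where "norm_fsvec x = sqrt (inner x x)"

definition sgn_fsvec :: "fsvec \<Rightarrow> fsvec"
  where "sgn_fsvec x = x /\<^sub>R norm x"

definition dist_fsvec :: "fsvec \<Rightarrow> fsvec \<Rightarrow> real"
  where "dist_fsvec x y = norm (x - y)"

definition uniformity_fsvec :: "(fsvec \<times> fsvec) filter"
  where "uniformity_fsvec = (INF e\<in>{0 <..}. principal {(x, y). dist x y < e})"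

definition open_fsvec :: "fsvec set \<Rightarrow> bool"
  where "open_fsvec U \<longleftrightarrow> (\<forall>x\<in>U. \<forall>\<^sub>F (x', y) in uniformity. x' = x \<longrightarrow> y \<in> U)"

lemma inner_fsvec_superset:
  assumes "finite S" "{i. coord x i \<noteq> 0} \<subseteq> S"
  shows "inner x y = (\<Sum>i\<in>S. coord x i * coord y i)"
  unfolding inner_fsvec_def using assms by (intro sum.mono_neutral_left) auto

instance
proof
  fix x y z :: fsvec and r :: real
  define S where "S = {i. coord x i \<noteq> 0} \<union> {i. coord y i \<noteq> 0}"
  have S: "finite S" "{i. coord x i \<noteq> 0} \<subseteq> S" "{i. coord y i \<noteq> 0} \<subseteq> S"
    by (auto simp: S_def)
  have xy: "{i. coord (x + y) i \<noteq> 0} \<subseteq> S" "{i. coord (r *\<^sub>R x) i \<noteq> 0} \<subseteq> S"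
    by (auto simp: S_def plus_fsvec.rep_eq scaleR_fsvec.rep_eq)
  show "inner x y = inner y x"
    using inner_fsvec_superset[OF S(1,2)] inner_fsvec_superset[OF S(1,3)]
    by (simp add: mult.commute)
  show "inner (x + y) z = inner x z + inner y z"
    using inner_fsvec_superset[OF S(1,2)] inner_fsvec_superset[OF S(1,3)]
      inner_fsvec_superset[OF S(1) xy(1)]
    by (simp add: plus_fsvec.rep_eq distrib_right sum.distrib)
  show "inner (r *\<^sub>R x) y = r * inner x y"
    using inner_fsvec_superset[OF S(1,2)] inner_fsvec_superset[OF S(1) xy(2)]
    by (simp add: scaleR_fsvec.rep_eq sum_distrib_left mult.assoc)
  show "0 \<le> inner x x"
    unfolding inner_fsvec_def by (rule sum_nonneg) simp
  show "inner x x = 0 \<longleftrightarrow> x = 0"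
  proof
    assume "inner x x = 0"
    then have "\<forall>i\<in>{i. coord x i \<noteq> 0}. coord x i * coord x i = 0"
      unfolding inner_fsvec_def by (subst (asm) sum_nonneg_eq_0_iff) auto
    then show "x = 0"
      by (intro fsvec_eqI) (auto simp: zero_fsvec.rep_eq)
  qed (simp add: inner_fsvec_def zero_fsvec.rep_eq)
  show "norm x = sqrt (inner x x)" by (rule norm_fsvec_def)
  show "sgn x = x /\<^sub>R norm x" by (rule sgn_fsvec_def)
  show "dist x y = norm (x - y)" by (rule dist_fsvec_def)
next
  show "uniformity = (INF e\<in>{0 <..}. principal {(x :: fsvec, y). dist x y < e})"
    by (rule uniformity_fsvec_def)
next
  fix U :: "fsvec set"
  show "open U \<longleftrightarrow> (\<forall>x\<in>U. \<forall>\<^sub>F (x', y) in uniformity. x' = x \<longrightarrow> y \<in> U)"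
    by (rule open_fsvec_def)
qed

end

definition Rn :: "nat \<Rightarrow> fsvec set"
  where "Rn d = {x. \<forall>i\<ge>d. coord x i = 0}"

text \<open>
  In the definitions below, \<open>E\<close> is the space \<open>\<real>\<^sup>d\<close> (as a subspace of the ambient type), and
  symmetric matrices are represented by the linear self-maps of \<open>E\<close> they induce.  Such a map
  is only ever evaluated on \<open>E\<close>.
\<close>

text \<open>Euclidean operator norm of a map on \<open>E\<close>, i.e. \<^const>\<open>onorm\<close> relative to \<open>E\<close>.\<close>

definition onorm_on :: "'a::real_inner set \<Rightarrow> ('a \<Rightarrow> 'a) \<Rightarrow> real"
  where "onorm_on E A = (SUP v\<in>E. norm (A v) / norm v)"

definition is_gradient_on :: "'a::real_inner set \<Rightarrow> ('a \<Rightarrow> real) \<Rightarrow> ('a \<Rightarrow> 'a) \<Rightarrow> bool"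
  where "is_gradient_on E f grad \<longleftrightarrow>
    (\<forall>x\<in>E. grad x \<in> E \<and> (f has_derivative (\<lambda>h. grad x \<bullet> h)) (at x within E))"

text \<open>The Hessian is the (total) derivative of the gradient.\<close>

definition is_hessian_on :: "'a::real_inner set \<Rightarrow> ('a \<Rightarrow> 'a) \<Rightarrow> ('a \<Rightarrow> 'a \<Rightarrow> 'a) \<Rightarrow> bool"
  where "is_hessian_on E grad hess \<longleftrightarrow>
    (\<forall>x\<in>E. hess x ` E \<subseteq> E \<and> (grad has_derivative hess x) (at x within E))"

text \<open>\<open>f\<close> is twice continuously differentiable on \<open>E\<close> with the given gradient and Hessian.\<close>

definition C2_on ::
    "'a::real_inner set \<Rightarrow> ('a \<Rightarrow> real) \<Rightarrow> ('a \<Rightarrow> 'a) \<Rightarrow> ('a \<Rightarrow> 'a \<Rightarrow> 'a) \<Rightarrow> bool"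
  where "C2_on E f grad hess \<longleftrightarrow>
    is_gradient_on E f grad \<and> is_hessian_on E grad hess \<and>
    (\<forall>x\<in>E. ((\<lambda>y. onorm_on E (\<lambda>v. hess y v - hess x v)) \<longlongrightarrow> 0) (at x within E))"

definition krylov :: "nat \<Rightarrow> ('a::real_inner \<Rightarrow> 'a) \<Rightarrow> 'a \<Rightarrow> 'a set"
  where "krylov j A b = span {(A ^^ i) b | i. i < j}"

text \<open>
  The infimum in \<^const>\<open>infdist\<close> and, for \<open>j \<ge> 1\<close> and \<open>b \<noteq> 0\<close>, the supremum below are
  attained for linear \<open>A\<close>, since a Krylov subspace is finite-dimensional.
\<close>

definition krylov_sigma :: "nat \<Rightarrow> ('a::real_inner \<Rightarrow> 'a) \<Rightarrow> 'a \<Rightarrow> real"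
  where "krylov_sigma j A b =
    (if b = 0 then 0
     else SUP w\<in>{w \<in> krylov j A b. norm w = 1}. infdist (A w) (krylov j A b))"

definition krylov_rho :: "nat \<Rightarrow> ('a::real_inner \<Rightarrow> 'a) \<Rightarrow> 'a \<Rightarrow> real"
  where "krylov_rho m A b = (\<Prod>j=1..m. krylov_sigma j A b) powr (1 / real m)"

definition cubic_model :: "real \<Rightarrow> ('a::real_inner \<Rightarrow> 'a) \<Rightarrow> 'a \<Rightarrow> 'a \<Rightarrow> real"
  where "cubic_model M A b s = b \<bullet> s + 1 / 2 * (s \<bullet> A s) + M / 6 * norm s ^ 3"

definition krylov_crn_seq ::
    "nat \<Rightarrow> real \<Rightarrow> ('a::real_inner \<Rightarrow> 'a) \<Rightarrow> ('a \<Rightarrow> 'a \<Rightarrow> 'a) \<Rightarrow> (nat \<Rightarrow> 'a) \<Rightarrow> bool"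
  where "krylov_crn_seq m M grad hess x \<longleftrightarrow>
    (\<forall>k. \<exists>s. is_arg_min (cubic_model M (hess (x k)) (grad (x k)))
               (\<lambda>s. s \<in> krylov m (hess (x k)) (grad (x k))) s \<and>
             x (Suc k) = x k + s)"

text \<open>
  \<open>\<rho>\<^sub>m\<^sub>a\<^sub>x\<close> over the iterates \<open>0, \<dots>, k - 1\<close>; only meaningful for \<open>k \<ge> 1\<close>.
\<close>

definition krylov_rho_max ::
    "nat \<Rightarrow> ('a::real_inner \<Rightarrow> 'a) \<Rightarrow> ('a \<Rightarrow> 'a \<Rightarrow> 'a) \<Rightarrow> (nat \<Rightarrow> 'a) \<Rightarrow> nat \<Rightarrow> real"
  where "krylov_rho_max m grad hess x k =
    Max ((\<lambda>i. krylov_rho m (hess (x i)) (grad (x i))) ` {..<k})"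

text \<open>
  Two remarks on the iteration count in the theorem.  First, \<open>N\<close> is the first iteration with
  \<open>\<delta>\<^sub>N \<le> \<epsilon>\<close>; it is 0 exactly if \<open>\<delta>\<^sub>0 \<le> \<epsilon>\<close>, and then there is no maximum over earlier
  iterates to speak of.  Second, the count is compared with the real-valued bound rounded up to
  an integer.  The rounding cannot be dropped: the real-valued bound tends to 0 as \<open>\<epsilon>\<close> tends
  to \<open>\<delta>\<^sub>0\<close> from below and \<open>L\<^sub>2 + M\<close> tends to 0, while at least one iteration is needed
  whenever \<open>\<epsilon> < \<delta>\<^sub>0\<close>.
\<close>

end

theory Submission
  imports Defs
begin

text \<open>
  Write \<open>\<beta>\<^sub>j\<close> for \<open>\<sigma>\<^sup>(\<^sup>j\<^sup>)\<close>.  With respect to the flag \<open>K\<^sub>1 \<subseteq> \<dots> \<subseteq> K\<^sub>m\<close> of Krylov subspaces the Hessian \<open>H\<close> is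
  block tridiagonal with off-diagonal entries bounded by \<open>\<beta>\<^sub>j\<close>.  Multiplying the component of
  a vector \<open>v\<close> in \<open>K\<^sub>j \<ominus> K\<^sub>j\<^sub>-\<^sub>1\<close> by \<open>cos \<phi>\<^sub>j\<close>, where the angles increase from \<open>0\<close> to \<open>\<pi>/2\<close>,
  gives a vector \<open>w \<in> K\<^sub>m\<close> with \<open>g \<bullet> w = g \<bullet> v\<close>.  The complementary vector with factors
  \<open>sin \<phi>\<^sub>j\<close> has nonnegative energy, so (as in the IMS localization formula) \<open>w \<bullet> H w\<close> exceeds
  \<open>v \<bullet> H v\<close> by at most \<open>max\<^sub>j \<beta>\<^sub>j (\<phi>\<^sub>j\<^sub>+\<^sub>1 - \<phi>\<^sub>j)\<^sup>2 \<parallel>v\<parallel>\<^sup>2\<close>.  Angle increments proportional to \<open>1/\<surd>\<beta>\<^sub>j\<close>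
  and the AM-GM inequality turn the maximum into \<open>(\<pi>/2)\<^sup>2 \<rho>\<^sup>(\<^sup>m\<^sup>) / m\<^sup>2\<close>, which is even
  better than the required \<open>\<rho>\<^sup>(\<^sup>m\<^sup>) / m\<close>.

  With \<open>v = \<eta> (x\<^sup>* - x\<^sub>k)\<close>, convexity and strong convexity this yields
  \<open>\<delta>\<^sub>k\<^sub>+\<^sub>1 \<le> (1 - h) \<delta>\<^sub>k\<close>, where \<open>1/h\<close> is of order \<open>1 + \<rho>/(m \<mu>) + \<surd>(L\<^sub>2 + M) \<delta>\<^sub>k\<^sup>1\<^sup>/\<^sup>4 / \<mu>\<^sup>3\<^sup>/\<^sup>4\<close>,
  and a potential argument counts the iterations.
\<close>

section \<open>Orthogonal projections and weights\<close>

text \<open>Gram-Schmidt by induction on \<open>S\<close>: the new vector \<open>b\<close> is made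
  orthogonal to the old span before the component of \<open>z\<close> along it is added. This works
  in every inner product space, which matters because the ambient space is
  infinite-dimensional.\<close>

lemma orthogonal_decomposition_span_finite:
  fixes z :: "'a::real_inner"
  assumes "finite S"
  shows "\<exists>p\<in>span S. \<forall>y\<in>span S. (z - p) \<bullet> y = 0"
  using assms
proof (induction S arbitrary: z)
  case empty
  then show ?case by simp
next
  case (insert b S)
  obtain q where q: "q \<in> span S" "\<forall>y\<in>span S. (b - q) \<bullet> y = 0" using insert.IH by blast
  obtain p where p: "p \<in> span S" "\<forall>y\<in>span S. (z - p) \<bullet> y = 0" using insert.IH by blast
  define c where "c = b - q"
  define t where "t = ((z - p) \<bullet> c) / (c \<bullet> c)"
  have sub: "span S \<subseteq> span (insert b S)" by (rule span_mono) blast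
  have "c \<in> span (insert b S)" unfolding c_def using q(1) sub by (simp add: span_base span_diff subsetD)
  then have in_span: "p + t *\<^sub>R c \<in> span (insert b S)"
    using p(1) sub by (meson span_add span_scale subsetD)
  \<comment> \<open>If \<open>c = 0\<close>, then \<open>t\<close> is a quotient by zero, hence 0,
    and both sides vanish.\<close>
  have t: "(z - p) \<bullet> c = t * (c \<bullet> c)" by (cases "c = 0") (simp_all add: t_def)
  have "(z - (p + t *\<^sub>R c)) \<bullet> y = 0" if "y \<in> span (insert b S)" for y
  proof -
    obtain k where "y - k *\<^sub>R b \<in> span S" using \<open>y \<in> span (insert b S)\<close> span_breakdown_eq by blast
    then have "(y - k *\<^sub>R b) + k *\<^sub>R q \<in> span S" using q(1) by (simp add: span_add span_scale)
    then have w: "y - k *\<^sub>R c \<in> span S" by (simp add: c_def algebra_simps)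
    then have "(z - p) \<bullet> (y - k *\<^sub>R c) = 0" "c \<bullet> (y - k *\<^sub>R c) = 0"
      using p(2) q(2) by (auto simp: c_def)
    then show ?thesis using t by (simp add: inner_diff inner_add algebra_simps)
  qed
  then show ?case using in_span by blast
qed

section \<open>Angle increments from the arithmetic-geometric mean inequality\<close>

lemma sqrt_prod: "(\<Prod>i\<in>A. sqrt (f i)) = sqrt (\<Prod>i\<in>A. f i)"
  by (induction A rule: infinite_finite_induct) (simp_all add: real_sqrt_mult)

text \<open>Increments proportional to \<open>1 / sqrt (\<beta> i)\<close> make all products on the
  left equal to \<open>(pi / 2)^2 / S^2\<close>, where \<open>S\<close> is the normaliser; AM-GM for
  the numbers \<open>1 / sqrt (\<beta> i)\<close> bounds \<open>S\<close> from below.\<close>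

lemma angles_from_weights:
  fixes \<beta> :: "nat \<Rightarrow> real"
  assumes "m \<ge> 1" and nonneg: "\<And>i. i < m \<Longrightarrow> \<beta> i \<ge> 0"
  shows "\<exists>\<Delta>. (\<Sum>i<m. \<Delta> i) = pi / 2 \<and>
    (\<forall>i<m. \<beta> i * (\<Delta> i)\<^sup>2 \<le> (pi / 2)\<^sup>2 * (\<Prod>i<m. \<beta> i) powr (1 / real m) / (real m)\<^sup>2)"
proof (cases "\<exists>i<m. \<beta> i = 0")
  case True
  then obtain i where "i < m" "\<beta> i = 0" by blast
  then show ?thesis
    \<comment> \<open>A vanishing weight takes the whole angle, so every product on the left is 0.
      In the application this means that some Krylov subspace is invariant.\<close>
    by (intro exI[of _ "\<lambda>j. if j = i then pi / 2 else 0"]) (simp add: sum.delta)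
next
  case False
  with nonneg have pos: "\<beta> i > 0" if "i < m" for i using that by (metis less_eq_real_def)
  define P where "P = (\<Prod>i<m. \<beta> i)"
  define S where "S = (\<Sum>i<m. 1 / sqrt (\<beta> i))"
  have P: "P > 0" unfolding P_def by (rule prod_pos) (simp add: pos)
  have S: "S > 0" unfolding S_def using pos \<open>m \<ge> 1\<close>
    by (intro sum_pos) (auto simp: lessThan_empty_iff)
  have "(\<Prod>i<m. 1 / sqrt (\<beta> i)) powr (1 / real m) \<le> S / real m"
    using arith_geom_mean[of "{..<m}" "\<lambda>i. 1 / sqrt (\<beta> i)"] \<open>m \<ge> 1\<close> nonneg
    by (auto simp: S_def sum_divide_distrib lessThan_empty_iff)
  also have "(\<Prod>i<m. 1 / sqrt (\<beta> i)) = 1 / sqrt P"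
    by (simp add: P_def prod_dividef sqrt_prod)
  finally have "(1 / sqrt P) powr (1 / real m) \<le> S / real m" .
  then have "((1 / sqrt P) powr (1 / real m))\<^sup>2 \<le> (S / real m)\<^sup>2"
    by (intro power_mono) auto
  moreover have "((1 / sqrt P) powr (1 / real m))\<^sup>2 = 1 / P powr (1 / real m)"
  proof -
    have "((1 / sqrt P) powr (1 / real m))\<^sup>2 = ((1 / sqrt P)\<^sup>2) powr (1 / real m)"
      using P unfolding power2_eq_square by (subst powr_mult) auto
    also have "(1 / sqrt P)\<^sup>2 = 1 / P" using P by (simp add: power_divide)
    finally show ?thesis using P by (simp add: powr_divide)
  qed
  ultimately have *: "1 / P powr (1 / real m) \<le> S\<^sup>2 / (real m)\<^sup>2" by (simp add: power_divide)
  have "P powr (1 / real m) > 0" using P by simp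
  with * have **: "1 / S\<^sup>2 \<le> P powr (1 / real m) / (real m)\<^sup>2"
    using S \<open>m \<ge> 1\<close> by (simp add: field_simps)
  define \<Delta> where "\<Delta> i = pi / 2 * (1 / sqrt (\<beta> i)) / S" for i
  have "(\<Sum>i<m. \<Delta> i) = pi / 2 * S / S"
    unfolding \<Delta>_def S_def by (simp only: sum_divide_distrib sum_distrib_left)
  moreover have "\<beta> i * (\<Delta> i)\<^sup>2 \<le> (pi / 2)\<^sup>2 * P powr (1 / real m) / (real m)\<^sup>2" if "i < m" for i
  proof -
    have "\<beta> i * (\<Delta> i)\<^sup>2 = (pi / 2)\<^sup>2 * (1 / S\<^sup>2)"
      using pos[OF that] S by (simp add: \<Delta>_def power_divide power_mult_distrib)
    also have "\<dots> \<le> (pi / 2)\<^sup>2 * (P powr (1 / real m) / (real m)\<^sup>2)"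
      using ** by (intro mult_left_mono) auto
    finally show ?thesis by simp
  qed
  ultimately show ?thesis using S unfolding P_def by (intro exI[of _ \<Delta>]) simp
qed

section \<open>Krylov subspaces\<close>

lemma krylov_mono: "i \<le> j \<Longrightarrow> krylov i A b \<subseteq> krylov j A b"
  unfolding krylov_def by (rule span_mono) auto

lemma subspace_krylov: "subspace (krylov j A b)"
  by (simp add: krylov_def)

lemma start_in_krylov: "j \<ge> 1 \<Longrightarrow> b \<in> krylov j A b"
  unfolding krylov_def by (intro span_base) (auto intro!: exI[of _ 0])

lemma image_krylov_subset:
  assumes "bounded_linear A" "w \<in> krylov j A b"
  shows "A w \<in> krylov (Suc j) A b"
proof -
  interpret A: bounded_linear A by fact
  from assms(2) show ?thesis unfolding krylov_def
  proof (induction rule: span_induct_alt)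
    case base
    then show ?case by (simp add: A.zero span_zero)
  next
    case (step c x y)
    then obtain i where "i < j" "x = (A ^^ i) b" by auto
    then have "A x \<in> span {(A ^^ i) b |i. i < Suc j}"
      by (intro span_base) (auto intro!: exI[of _ "Suc i"])
    with step show ?case by (simp add: A.add A.scaleR span_add span_scale)
  qed
qed

lemma krylov_subset:
  assumes "subspace E" "A ` E \<subseteq> E" "b \<in> E"
  shows "krylov j A b \<subseteq> E"
proof -
  have "(A ^^ i) b \<in> E" for i by (induction i) (use assms in auto)
  then show ?thesis unfolding krylov_def by (intro span_minimal assms) auto
qed

lemma krylov_projection:
  "\<exists>p\<in>krylov j A b. \<forall>y\<in>krylov j A b. (z - p) \<bullet> y = 0"
  unfolding krylov_def by (rule orthogonal_decomposition_span_finite) simp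

section \<open>Bounds for \<open>krylov_sigma\<close> and \<open>krylov_rho\<close>\<close>

lemma krylov_sigma_upper:
  assumes "bounded_linear A" "b \<noteq> 0" "w \<in> krylov j A b" "norm w = 1"
  shows "infdist (A w) (krylov j A b) \<le> krylov_sigma j A b"
proof -
  obtain K where K: "\<And>v. norm (A v) \<le> norm v * K"
    using bounded_linear.bounded[OF assms(1)] by blast
  \<comment> \<open>A supremum of reals is informative only for a bounded set; comparing with the
    point 0 of the subspace bounds all distances by \<open>K\<close>.\<close>
  have "infdist (A v) (krylov j A b) \<le> K" if "norm v = 1" for v
  proof -
    have "0 \<in> krylov j A b" by (simp add: krylov_def span_zero)
    then have "infdist (A v) (krylov j A b) \<le> dist (A v) 0" by (rule infdist_le)
    then show ?thesis using K[of v] that by simp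
  qed
  then have "bdd_above ((\<lambda>w. infdist (A w) (krylov j A b)) ` {w \<in> krylov j A b. norm w = 1})"
    by (auto simp: bdd_above_def)
  then show ?thesis unfolding krylov_sigma_def using assms by (auto intro!: cSUP_upper)
qed

lemma krylov_unit:
  assumes "b \<noteq> 0" "j \<ge> 1"
  shows "b /\<^sub>R norm b \<in> krylov j A b" "norm (b /\<^sub>R norm b) = 1"
  using assms start_in_krylov[of j b A] subspace_krylov[of j A b] by (auto intro: subspace_scale)

lemma krylov_sigma_nonneg:
  assumes "bounded_linear A" "j \<ge> 1"
  shows "krylov_sigma j A b \<ge> 0"
proof (cases "b = 0")
  case False
  then show ?thesis
    using krylov_sigma_upper[OF assms(1) False krylov_unit[OF False assms(2)]] infdist_nonneg order_trans
    by blast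
qed (simp add: krylov_sigma_def)

text \<open>Since 0 lies in the Krylov subspace, the distance of \<open>A w\<close> from it is at
  most \<open>norm (A w)\<close>.\<close>

lemma krylov_sigma_le:
  assumes "j \<ge> 1" "B \<ge> 0"
    and bound: "\<And>w. w \<in> krylov j A b \<Longrightarrow> norm w = 1 \<Longrightarrow> norm (A w) \<le> B"
  shows "krylov_sigma j A b \<le> B"
proof (cases "b = 0")
  case False
  have "infdist (A w) (krylov j A b) \<le> B" if "w \<in> krylov j A b" "norm w = 1" for w
  proof -
    have "0 \<in> krylov j A b" by (simp add: krylov_def span_zero)
    then have "infdist (A w) (krylov j A b) \<le> dist (A w) 0" by (rule infdist_le)
    then show ?thesis using bound[OF that] by simp
  qed
  moreover have "{w \<in> krylov j A b. norm w = 1} \<noteq> {}"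
    using krylov_unit(1)[OF False assms(1), of A] krylov_unit(2)[OF False assms(1)] by blast
  ultimately show ?thesis unfolding krylov_sigma_def using False by (auto intro!: cSUP_least)
qed (use assms(2) in \<open>simp add: krylov_sigma_def\<close>)

text \<open>A geometric mean of numbers between 0 and \<open>B\<close> is at most \<open>B\<close>.
  This serves to show that the method terminates.\<close>

lemma krylov_rho_le:
  assumes "bounded_linear A" "m \<ge> 1" "B \<ge> 0"
    and bound: "\<And>w. w \<in> krylov m A b \<Longrightarrow> norm w = 1 \<Longrightarrow> norm (A w) \<le> B"
  shows "krylov_rho m A b \<le> B"
proof -
  have "(\<Prod>j=1..m. krylov_sigma j A b) \<le> (\<Prod>j=1..m. B)"
  proof (rule prod_mono)
    fix j assume "j \<in> {1..m}"
    then show "0 \<le> krylov_sigma j A b \<and> krylov_sigma j A b \<le> B"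
      using assms krylov_mono[of j m A b] by (auto intro!: krylov_sigma_nonneg krylov_sigma_le)
  qed
  then have "krylov_rho m A b \<le> (B ^ m) powr (1 / real m)"
    unfolding krylov_rho_def using assms
    by (intro powr_mono2) (auto intro!: prod_nonneg krylov_sigma_nonneg)
  also have "\<dots> = B"
  proof (cases "B = 0")
    case False
    then show ?thesis using assms by (simp add: powr_realpow[symmetric] powr_powr)
  qed (use assms in \<open>simp add: power_0_left\<close>)
  finally show ?thesis .
qed

text \<open>As \<open>v\<close> is orthogonal to the subspace, any of its points \<open>p\<close>
  may be subtracted from \<open>A w\<close> without changing the product with \<open>v\<close>.
  Cauchy-Schwarz and the infimum over \<open>p\<close> then bring in the distance; these products
  are the off-diagonal entries.\<close>

lemma inner_le_krylov_sigma:
  assumes A: "bounded_linear A" "b \<noteq> 0" and u: "u \<in> krylov j A b"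
    and v: "\<And>y. y \<in> krylov j A b \<Longrightarrow> v \<bullet> y = 0"
  shows "\<bar>v \<bullet> A u\<bar> \<le> krylov_sigma j A b * norm u * norm v"
proof (cases "u = 0 \<or> v = 0")
  case True
  then show ?thesis using bounded_linear.linear[OF A(1)] by (auto simp: linear_0)
next
  case False
  define w where "w = u /\<^sub>R norm u"
  have w: "w \<in> krylov j A b" "norm w = 1"
    using False u subspace_krylov[of j A b] by (auto simp: w_def intro: subspace_scale)
  have "\<bar>v \<bullet> A w\<bar> / norm v \<le> infdist (A w) (krylov j A b)"
    unfolding infdist_notempty[OF ex_in_conv[THEN iffD1, OF exI, OF w(1)]]
  proof (rule cINF_greatest)
    fix p assume "p \<in> krylov j A b"
    then have "\<bar>v \<bullet> A w\<bar> = \<bar>v \<bullet> (A w - p)\<bar>" using v by (simp add: inner_diff_right)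
    also have "\<dots> \<le> norm v * dist (A w) p" unfolding dist_norm by (rule Cauchy_Schwarz_ineq2)
    finally show "\<bar>v \<bullet> A w\<bar> / norm v \<le> dist (A w) p" using False by (simp add: divide_le_eq mult.commute)
  qed (use w(1) in blast)
  also have "\<dots> \<le> krylov_sigma j A b" by (rule krylov_sigma_upper[OF A w])
  finally have "\<bar>v \<bullet> A w\<bar> \<le> krylov_sigma j A b * norm v" using False by (simp add: divide_le_eq)
  moreover have "A u = norm u *\<^sub>R A w"
    using False linear_scale[OF bounded_linear.linear[OF A(1)], of "norm u" w] by (simp add: w_def)
  ultimately show ?thesis using mult_left_mono[of "\<bar>v \<bullet> A w\<bar>" "krylov_sigma j A b * norm v" "norm u"]
    by (simp add: abs_mult mult_ac)
qed

section \<open>Localization on a Krylov subspace\<close>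

lemma norm_sum_orthogonal_sq:
  fixes z :: "nat \<Rightarrow> 'a::real_inner"
  assumes "finite I" "\<And>i j. i \<in> I \<Longrightarrow> j \<in> I \<Longrightarrow> i \<noteq> j \<Longrightarrow> z i \<bullet> z j = 0"
  shows "(norm (\<Sum>i\<in>I. c i *\<^sub>R z i))\<^sup>2 = (\<Sum>i\<in>I. (c i)\<^sup>2 * (norm (z i))\<^sup>2)"
proof -
  have "(norm (\<Sum>i\<in>I. c i *\<^sub>R z i))\<^sup>2 = (\<Sum>i\<in>I. \<Sum>j\<in>I. c i * c j * (z i \<bullet> z j))"
    by (simp add: power2_norm_eq_inner inner_sum_left inner_sum_right inner_commute mult_ac
        sum_distrib_left)
  also have "\<dots> = (\<Sum>i\<in>I. \<Sum>j\<in>I. if j = i then (c i)\<^sup>2 * (norm (z i))\<^sup>2 else 0)"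
    using assms(2) by (intro sum.cong refl) (auto simp: dot_square_norm power2_eq_square)
  finally show ?thesis using assms(1) by (simp add: sum.delta)
qed

lemma one_minus_cos_le: "1 - cos x \<le> x\<^sup>2 / 2" for x :: real
proof -
  have "cos x = 1 - 2 * (sin (x / 2))\<^sup>2" using cos_double_sin[of "x / 2"] by simp
  moreover have "(sin (x / 2))\<^sup>2 \<le> (x / 2)\<^sup>2"
    using abs_sin_x_le_abs_x[of "x / 2"] by (metis abs_le_square_iff)
  ultimately show ?thesis by (simp add: power_divide)
qed

lemma sum_adjacent_pairs:
  fixes f :: "nat \<Rightarrow> nat \<Rightarrow> real"
  shows "(\<Sum>i\<le>m. \<Sum>j\<le>m. if j = Suc i then f i j else 0) = (\<Sum>i<m. f i (Suc i))"
proof -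
  have "(\<Sum>i\<le>m. \<Sum>j\<le>m. if j = Suc i then f i j else 0) = (\<Sum>i\<le>m. if i < m then f i (Suc i) else 0)"
    by (intro sum.cong refl) (simp add: sum.delta)
  also have "\<dots> = (\<Sum>i\<in>{i\<in>{..m}. i < m}. f i (Suc i))"
    by (rule sum.inter_filter[symmetric]) simp
  also have "{i\<in>{..m}. i < m} = {..<m}" by auto
  finally show ?thesis .
qed

text \<open>The addition theorem for the cosine kills the diagonal in the difference of energies;
  between neighbours the factor \<open>1 - cos (\<Delta> i)\<close> is of second order in the
  increment. The last piece \<open>z m\<close> receives the factor cos (pi/2) = 0 and so drops out
  of \<open>w\<close>.\<close>

lemma tridiagonal_localization:
  fixes z :: "nat \<Rightarrow> 'a::real_inner" and \<Delta> :: "nat \<Rightarrow> real"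
  assumes lin: "linear A" and E: "subspace E" "\<And>i. i \<le> m \<Longrightarrow> z i \<in> E"
    and sym: "\<And>u v. u \<in> E \<Longrightarrow> v \<in> E \<Longrightarrow> u \<bullet> A v = v \<bullet> A u"
    and psd: "\<And>v. v \<in> E \<Longrightarrow> v \<bullet> A v \<ge> 0"
    and orth: "\<And>i j. i \<le> m \<Longrightarrow> j \<le> m \<Longrightarrow> i \<noteq> j \<Longrightarrow> z i \<bullet> z j = 0"
    and far: "\<And>i j. j \<le> m \<Longrightarrow> Suc i < j \<Longrightarrow> z j \<bullet> A (z i) = 0"
    and near: "\<And>i. i < m \<Longrightarrow> \<bar>z (Suc i) \<bullet> A (z i)\<bar> \<le> \<beta> i * norm (z i) * norm (z (Suc i))"
    and angles: "(\<Sum>i<m. \<Delta> i) = pi / 2" "\<And>i. i < m \<Longrightarrow> \<beta> i * (\<Delta> i)\<^sup>2 \<le> \<kappa>" "\<kappa> \<ge> 0"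
  defines "w \<equiv> (\<Sum>i<m. cos (\<Sum>l<i. \<Delta> l) *\<^sub>R z i)" and "v \<equiv> (\<Sum>i\<le>m. z i)"
  shows "norm w \<le> norm v" "w \<bullet> A w \<le> v \<bullet> A v + \<kappa> * (norm v)\<^sup>2"
proof -
  define \<phi> where "\<phi> i = (\<Sum>l<i. \<Delta> l)" for i
  define q where "q i j = z i \<bullet> A (z j)" for i j
  define w' where "w' = (\<Sum>i\<le>m. sin (\<phi> i) *\<^sub>R z i)"
  have \<phi>: "\<phi> m = pi / 2" "\<And>i. \<phi> (Suc i) = \<phi> i + \<Delta> i" using angles(1) by (simp_all add: \<phi>_def)
  \<comment> \<open>This allows the sum defining \<open>w\<close> to be extended from
    \<open>i < m\<close> to \<open>i \<le> m\<close>.\<close>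
  have cos_phi: "cos (\<phi> m) = 0" by (simp only: \<phi>(1) cos_pi_half)
  have w: "w = (\<Sum>i\<le>m. cos (\<phi> i) *\<^sub>R z i)"
    unfolding w_def \<phi>_def[symmetric] using cos_phi by (simp add: lessThan_Suc_atMost[symmetric])
  have norm_v: "(norm v)\<^sup>2 = (\<Sum>i\<le>m. (norm (z i))\<^sup>2)"
    using norm_sum_orthogonal_sq[of "{..m}" z "\<lambda>_. 1"] orth by (simp add: v_def)
  have "(norm w)\<^sup>2 = (\<Sum>i\<le>m. (cos (\<phi> i))\<^sup>2 * (norm (z i))\<^sup>2)"
    unfolding w by (rule norm_sum_orthogonal_sq) (simp_all add: orth)
  also have "\<dots> \<le> (\<Sum>i\<le>m. (norm (z i))\<^sup>2)"
    by (intro sum_mono mult_left_le_one_le) (auto simp: abs_square_le_1)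
  finally show "norm w \<le> norm v" by (simp add: norm_v[symmetric])
  have quad: "(\<Sum>i\<le>m. c i *\<^sub>R z i) \<bullet> A (\<Sum>i\<le>m. c i *\<^sub>R z i) = (\<Sum>i\<le>m. \<Sum>j\<le>m. c i * c j * q i j)" for c
    by (subst sum.swap) (simp add: q_def linear_sum[OF lin] linear_scale[OF lin] inner_sum_left inner_sum_right
        sum_distrib_left mult_ac)
  \<comment> \<open>The products of cosines and of sines combine to the cosine of the angle
    difference.\<close>
  have split: "v \<bullet> A v - (w \<bullet> A w + w' \<bullet> A w') = (\<Sum>i\<le>m. \<Sum>j\<le>m. (1 - cos (\<phi> i - \<phi> j)) * q i j)"
    unfolding w w'_def quad using quad[of "\<lambda>_. 1"]
    by (simp add: v_def sum_subtractf[symmetric] sum.distrib[symmetric] cos_diff algebra_simps)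
  \<comment> \<open>\<open>N\<close> bounds one off-diagonal entry once the product of the two norms
    is split by AM-GM; by symmetry each pair occurs twice in the double sum.\<close>
  define N where "N i j = \<kappa> / 4 * ((norm (z i))\<^sup>2 + (norm (z j))\<^sup>2)" for i j
  have N0: "N i j \<ge> 0" for i j using angles(3) by (simp add: N_def)
  have step: "\<bar>(1 - cos (\<Delta> i)) * q (Suc i) i\<bar> \<le> N i (Suc i)" if "i < m" for i
  proof -
    have "\<bar>(1 - cos (\<Delta> i)) * q (Suc i) i\<bar> \<le> ((\<Delta> i)\<^sup>2 / 2) * (\<beta> i * norm (z i) * norm (z (Suc i)))"
      unfolding abs_mult q_def using near[OF that] one_minus_cos_le[of "\<Delta> i"] by (intro mult_mono) auto
    also have "\<dots> = (\<beta> i * (\<Delta> i)\<^sup>2) / 2 * (norm (z i) * norm (z (Suc i)))" by simp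
    also have "\<dots> \<le> \<kappa> / 2 * (norm (z i) * norm (z (Suc i)))"
      using angles(2)[OF that] by (intro mult_right_mono) auto
    also have "\<dots> \<le> \<kappa> / 2 * (((norm (z i))\<^sup>2 + (norm (z (Suc i)))\<^sup>2) / 2)"
      using angles(3) sum_squares_bound[of "norm (z i)" "norm (z (Suc i))"]
      by (intro mult_left_mono) auto
    finally show ?thesis by (simp add: N_def)
  qed
  have entry: "- ((1 - cos (\<phi> i - \<phi> j)) * q i j) \<le>
      (if j = Suc i then N i j else 0) + (if i = Suc j then N j i else 0)" if "i \<le> m" "j \<le> m" for i j
  proof -
    have q_sym: "q i j = q j i" using sym E(2) that by (simp add: q_def)
    consider "j = Suc i" | "i = Suc j" | "i = j" | "Suc i < j" | "Suc j < i" by linarith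
    then show ?thesis
    proof cases
      case 1
      then have "\<bar>(1 - cos (\<phi> i - \<phi> j)) * q i j\<bar> \<le> N i j"
        using step[of i] that q_sym \<phi>(2)[of i] by simp
      with 1 show ?thesis by simp
    next
      case 2
      then have "\<bar>(1 - cos (\<phi> i - \<phi> j)) * q i j\<bar> \<le> N j i"
        using step[of j] that \<phi>(2)[of j] by simp
      with 2 show ?thesis by simp
    next
      case 3 then show ?thesis using N0 by simp
    next
      case 4 then show ?thesis using far that q_sym by (simp add: q_def)
    next
      case 5 then show ?thesis using far that by (simp add: q_def)
    qed
  qed
  have "w \<bullet> A w + w' \<bullet> A w' - v \<bullet> A v = (\<Sum>i\<le>m. \<Sum>j\<le>m. - ((1 - cos (\<phi> i - \<phi> j)) * q i j))"
    using split by (simp add: sum_negf)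
  also have "\<dots> \<le> (\<Sum>i\<le>m. \<Sum>j\<le>m. (if j = Suc i then N i j else 0) + (if i = Suc j then N j i else 0))"
    by (intro sum_mono entry) auto
  also have "\<dots> = (\<Sum>i\<le>m. \<Sum>j\<le>m. if j = Suc i then N i j else 0) +
      (\<Sum>j\<le>m. \<Sum>i\<le>m. if i = Suc j then N j i else 0)"
    by (simp only: sum.distrib sum.swap[of "\<lambda>i j. if i = Suc j then N j i else 0"])
  also have "\<dots> = 2 * (\<Sum>i<m. N i (Suc i))" by (simp only: sum_adjacent_pairs)
  also have "(\<Sum>i<m. N i (Suc i)) = \<kappa> / 4 * ((\<Sum>i<m. (norm (z i))\<^sup>2) + (\<Sum>i<m. (norm (z (Suc i)))\<^sup>2))"
    by (simp only: N_def sum_distrib_left[symmetric] sum.distrib)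
  \<comment> \<open>Each squared norm occurs at most once in either sum, so the total is at most
    \<kappa> times the squared norm of \<open>v\<close>.\<close>
  also have "2 * \<dots> \<le> 2 * (\<kappa> / 4 * ((norm v)\<^sup>2 + (norm v)\<^sup>2))"
  proof -
    have "(\<Sum>i<m. (norm (z i))\<^sup>2) \<le> (norm v)\<^sup>2" unfolding norm_v by (intro sum_mono2) auto
    moreover have "(\<Sum>i<m. (norm (z (Suc i)))\<^sup>2) \<le> (norm v)\<^sup>2"
      unfolding norm_v by (subst sum.atMost_shift) auto
    ultimately show ?thesis using angles(3) by (intro mult_left_mono add_mono) auto
  qed
  finally have "w \<bullet> A w + w' \<bullet> A w' \<le> v \<bullet> A v + \<kappa> * (norm v)\<^sup>2" by simp
  \<comment> \<open>The sine-weighted vector has nonnegative energy, which can be discarded.\<close>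
  moreover have "w' \<in> E" unfolding w'_def by (intro subspace_sum subspace_scale E) auto
  then have "w' \<bullet> A w' \<ge> 0" by (rule psd)
  ultimately show "w \<bullet> A w \<le> v \<bullet> A v + \<kappa> * (norm v)\<^sup>2" by simp
qed

text \<open>Projecting \<open>v\<close> onto the successive Krylov subspaces gives the orthogonal
  pieces. Since \<open>A\<close> raises the Krylov index by at most one, a piece couples only with
  itself and its neighbours, and \<open>krylov_sigma\<close> bounds the coupling.\<close>

lemma krylov_localization:
  assumes A: "bounded_linear A" "A ` E \<subseteq> E" and E: "subspace E" "b \<in> E" "b \<noteq> 0" "v \<in> E"
    and sym: "\<And>u v. u \<in> E \<Longrightarrow> v \<in> E \<Longrightarrow> u \<bullet> A v = v \<bullet> A u"
    and psd: "\<And>v. v \<in> E \<Longrightarrow> v \<bullet> A v \<ge> 0" and "m \<ge> 1"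
  shows "\<exists>w\<in>krylov m A b. norm w \<le> norm v \<and> b \<bullet> w = b \<bullet> v \<and>
    w \<bullet> A w \<le> v \<bullet> A v + (pi / 2)\<^sup>2 * krylov_rho m A b / (real m)\<^sup>2 * (norm v)\<^sup>2"
proof -
  let ?K = "\<lambda>j. krylov j A b"
  obtain p where p: "\<And>j. p j \<in> ?K j" "\<And>j y. y \<in> ?K j \<Longrightarrow> (v - p j) \<bullet> y = 0"
    using krylov_projection[of _ A b v] by metis
  have "p 0 = 0" using p(1)[of 0] by (simp add: krylov_def)
  \<comment> \<open>For \<open>i < m\<close> the piece \<open>z i\<close> lies in
    \<open>krylov (Suc i) A b\<close> and is orthogonal to \<open>krylov i A b\<close>; the last one
    is the part of \<open>v\<close> that \<open>krylov m A b\<close> misses. Hence the shifted index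
    in \<beta> below.\<close>
  define z where "z i = (if i < m then p (Suc i) - p i else v - p m)" for i
  have K_E: "?K j \<subseteq> E" for j using krylov_subset[OF E(1) A(2) E(2)] .
  have z_K: "z i \<in> ?K (Suc i)" if "i < m" for i
    using that p(1)[of "Suc i"] p(1)[of i] krylov_mono[of i "Suc i" A b] subspace_krylov
    by (auto simp: z_def intro!: subspace_diff)
  have z_E: "z i \<in> E" for i
    using E p(1) K_E by (auto simp: z_def intro!: subspace_diff[OF E(1)])
  have z_orth: "z i \<bullet> y = 0" if "y \<in> ?K j" "j \<le> i" "i \<le> m" for i j y
  proof -
    have "y \<in> ?K i" "y \<in> ?K (Suc i)" using that krylov_mono[of j i A b] krylov_mono[of j "Suc i" A b] by auto
    then have "(v - p i) \<bullet> y = 0" "(v - p (Suc i)) \<bullet> y = 0" using p(2) by auto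
    then show ?thesis using that by (auto simp: z_def inner_diff_left)
  qed
  have sum_z: "(\<Sum>i\<le>m. z i) = v"
  proof -
    have "(\<Sum>i<m. z i) = (\<Sum>i<m. p (Suc i) - p i)" by (intro sum.cong) (auto simp: z_def)
    also have "\<dots> = p m" using \<open>p 0 = 0\<close> by (simp add: sum_lessThan_telescope)
    finally show ?thesis by (simp add: lessThan_Suc_atMost[symmetric] z_def)
  qed
  have less_orth: "z j \<bullet> z i = 0" if "i < j" "j \<le> m" for i j
    using z_orth[OF z_K[of i], of j] that by auto
  have orth: "z i \<bullet> z j = 0" if "i \<le> m" "j \<le> m" "i \<noteq> j" for i j
    using less_orth[of i j] less_orth[of j i] that by (metis inner_commute nat_neq_iff)
  have far: "z j \<bullet> A (z i) = 0" if "j \<le> m" "Suc i < j" for i j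
    using z_orth[OF image_krylov_subset[OF A(1) z_K[of i]], of j] that by auto
  define \<beta> where "\<beta> i = krylov_sigma (Suc i) A b" for i
  have near: "\<bar>z (Suc i) \<bullet> A (z i)\<bar> \<le> \<beta> i * norm (z i) * norm (z (Suc i))" if "i < m" for i
    unfolding \<beta>_def using inner_le_krylov_sigma[OF A(1) E(3) z_K[OF that], of "z (Suc i)"] z_orth that
    by (metis Suc_leI order_refl)
  have rho: "krylov_rho m A b = (\<Prod>i<m. \<beta> i) powr (1 / real m)"
    unfolding krylov_rho_def \<beta>_def by (simp add: prod.atLeast1_atMost_eq)
  obtain \<Delta> where \<Delta>: "(\<Sum>i<m. \<Delta> i) = pi / 2"
    "\<And>i. i < m \<Longrightarrow> \<beta> i * (\<Delta> i)\<^sup>2 \<le> (pi / 2)\<^sup>2 * krylov_rho m A b / (real m)\<^sup>2"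
    using angles_from_weights[OF \<open>m \<ge> 1\<close>, of \<beta>] krylov_sigma_nonneg[OF A(1)]
    unfolding rho \<beta>_def by (metis le_add1 plus_1_eq_Suc)
  define w where "w = (\<Sum>i<m. cos (\<Sum>l<i. \<Delta> l) *\<^sub>R z i)"
  have "0 \<le> (pi / 2)\<^sup>2 * krylov_rho m A b / (real m)\<^sup>2" by (simp add: krylov_rho_def)
  note loc = tridiagonal_localization[OF bounded_linear.linear[OF A(1)] E(1) z_E sym psd
      orth far near \<Delta> this, unfolded sum_z, folded w_def]
  have "w \<in> ?K m" unfolding w_def
  proof (intro subspace_sum subspace_scale subspace_krylov)
    fix i assume "i \<in> {..<m}"
    then show "z i \<in> ?K m" using z_K[of i] krylov_mono[of "Suc i" m A b] by auto
  qed
  moreover have "b \<bullet> w = b \<bullet> v"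
  proof -
    \<comment> \<open>Only \<open>z 0\<close> can meet \<open>b\<close>, and its factor is cos 0 =
      1; the linear term is therefore unchanged.\<close>
    have bz: "b \<bullet> z i = 0" if "1 \<le> i" "i \<le> m" for i
      using z_orth[OF start_in_krylov[of 1 b A], of i] that by (simp add: inner_commute)
    have "b \<bullet> w = (\<Sum>i<m. cos (\<Sum>l<i. \<Delta> l) * (b \<bullet> z i))" by (simp add: w_def inner_sum_right)
    also have "\<dots> = (\<Sum>i<m. b \<bullet> z i)"
    proof (rule sum.cong)
      fix i assume "i \<in> {..<m}"
      then show "cos (\<Sum>l<i. \<Delta> l) * (b \<bullet> z i) = b \<bullet> z i" using bz[of i] by (cases i) auto
    qed simp
    also have "\<dots> = b \<bullet> (\<Sum>i\<le>m. z i)"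
      using bz[of m] \<open>m \<ge> 1\<close> by (simp add: inner_sum_right inner_add_right lessThan_Suc_atMost[symmetric])
    finally show ?thesis by (simp only: sum_z)
  qed
  ultimately show ?thesis using loc by blast
qed

section \<open>Functions with a Lipschitz Hessian\<close>

text \<open>Boundedness of \<open>A\<close> makes the quotients bounded above, so their supremum
  dominates each of them. The quotient at 0 is 0 by convention.\<close>

lemma onorm_on_bound:
  assumes "bounded_linear A" "v \<in> E"
  shows "norm (A v) \<le> onorm_on E A * norm v"
proof (cases "v = 0")
  case True
  then show ?thesis using bounded_linear.linear[OF assms(1)] by (simp add: linear_0)
next
  case False
  obtain K where K: "\<And>v. norm (A v) \<le> norm v * K" using bounded_linear.bounded[OF assms(1)] by blast
  have "norm (A v) / norm v \<le> \<bar>K\<bar>" for v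
  proof (cases "v = 0")
    case False
    have "norm (A v) \<le> norm v * \<bar>K\<bar>"
      by (rule order_trans[OF K mult_left_mono]) auto
    with False show ?thesis by (simp add: divide_le_eq mult.commute)
  qed simp
  then have "bdd_above ((\<lambda>v. norm (A v) / norm v) ` E)" by (auto simp: bdd_above_def)
  then have "norm (A v) / norm v \<le> onorm_on E A"
    unfolding onorm_on_def using assms(2) by (rule cSUP_upper2) simp
  then show ?thesis using False by (simp add: divide_le_eq)
qed

text \<open>Replaces integration: the Taylor bounds below all compare derivatives along a
  ray.\<close>

lemma le_of_deriv_le:
  fixes p q p' q' :: "real \<Rightarrow> real"
  assumes "\<And>t. (p has_real_derivative p' t) (at t)" "\<And>t. (q has_real_derivative q' t) (at t)"
    and "\<And>t. 0 \<le> t \<Longrightarrow> p' t \<le> q' t" "p 0 \<le> q 0" "0 \<le> t"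
  shows "p t \<le> q t"
proof -
  have "q 0 - p 0 \<le> q t - p t"
  proof (rule DERIV_nonneg_imp_nondecreasing[OF \<open>0 \<le> t\<close>])
    fix s :: real assume "0 \<le> s"
    then show "\<exists>y. ((\<lambda>t. q t - p t) has_real_derivative y) (at s) \<and> 0 \<le> y"
      using assms(3)[of s] by (intro exI[of _ "q' s - p' s"]) (auto intro!: DERIV_diff assms(1,2))
  qed
  with assms(4) show ?thesis by simp
qed

section \<open>Taylor estimates and symmetry of the Hessian\<close>

locale C2_lipschitz =
  fixes E :: "'a::real_inner set" and f :: "'a \<Rightarrow> real" and grad :: "'a \<Rightarrow> 'a"
    and hess :: "'a \<Rightarrow> 'a \<Rightarrow> 'a" and L :: real
  assumes subspace: "subspace E" and C2: "C2_on E f grad hess"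
    and lipschitz: "\<And>y z. y \<in> E \<Longrightarrow> z \<in> E \<Longrightarrow> onorm_on E (\<lambda>v. hess y v - hess z v) \<le> L * norm (y - z)"
begin

lemma grad_in: "x \<in> E \<Longrightarrow> grad x \<in> E"
  and f_deriv: "x \<in> E \<Longrightarrow> (f has_derivative (\<lambda>h. grad x \<bullet> h)) (at x within E)"
  and hess_image: "x \<in> E \<Longrightarrow> hess x ` E \<subseteq> E"
  and grad_deriv: "x \<in> E \<Longrightarrow> (grad has_derivative hess x) (at x within E)"
  using C2 by (auto simp: C2_on_def is_gradient_on_def is_hessian_on_def)

text \<open>\<open>has_derivative\<close> includes bounded linearity on the whole ambient type,
  although the derivative is taken within \<open>E\<close>.\<close>

lemma hess_bounded_linear: "x \<in> E \<Longrightarrow> bounded_linear (hess x)"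
  using grad_deriv by (rule has_derivative_bounded_linear)

lemma ray_in: "x \<in> E \<Longrightarrow> v \<in> E \<Longrightarrow> x + t *\<^sub>R v \<in> E"
  using subspace by (simp add: subspace_add subspace_scale)

lemma norm_hess_diff:
  assumes "x \<in> E" "y \<in> E" "u \<in> E"
  shows "norm (hess y u - hess x u) \<le> L * norm (y - x) * norm u"
proof -
  have "norm (hess y u - hess x u) \<le> onorm_on E (\<lambda>v. hess y v - hess x v) * norm u"
    using assms hess_bounded_linear
    by (intro onorm_on_bound[of "\<lambda>v. hess y v - hess x v"] bounded_linear_sub) auto
  also have "\<dots> \<le> L * norm (y - x) * norm u"
    using assms by (intro mult_right_mono lipschitz) auto
  finally show ?thesis .
qed

lemma hess_diff:
  assumes "x \<in> E" "y \<in> E" "u \<in> E"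
  shows "\<bar>(hess y u - hess x u) \<bullet> v\<bar> \<le> L * norm (y - x) * norm u * norm v"
  using Cauchy_Schwarz_ineq2 mult_right_mono[OF norm_hess_diff[OF assms] norm_ge_zero]
  by (rule order_trans)

text \<open>The whole line stays in the subspace \<open>E\<close>, so the derivative within
  \<open>E\<close> becomes an ordinary two-sided derivative in \<open>t\<close>.\<close>

lemma f_ray_deriv:
  assumes "x \<in> E" "v \<in> E"
  shows "((\<lambda>t. f (x + t *\<^sub>R v)) has_real_derivative grad (x + t *\<^sub>R v) \<bullet> v) (at t)"
proof -
  have "((\<lambda>t. f (x + t *\<^sub>R v)) has_derivative (\<lambda>h. grad (x + t *\<^sub>R v) \<bullet> (h *\<^sub>R v))) (at t within UNIV)"
    by (rule has_derivative_in_compose2[where t = E and g' = "\<lambda>y h. grad y \<bullet> h"])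
      (auto intro!: f_deriv ray_in assms derivative_eq_intros)
  then show ?thesis by (simp add: has_field_derivative_def mult.commute[of _ "_ \<bullet> _"] mult_commute_abs)
qed

lemma grad_ray_deriv:
  assumes "x \<in> E" "v \<in> E"
  shows "((\<lambda>t. grad (x + t *\<^sub>R v) \<bullet> u) has_real_derivative hess (x + t *\<^sub>R v) v \<bullet> u) (at t)"
proof -
  have "((\<lambda>t. grad (x + t *\<^sub>R v)) has_derivative (\<lambda>h. hess (x + t *\<^sub>R v) (h *\<^sub>R v))) (at t within UNIV)"
    by (rule has_derivative_in_compose2[where t = E and g' = hess])
      (auto intro!: grad_deriv ray_in assms derivative_eq_intros)
  then have "((\<lambda>t. grad (x + t *\<^sub>R v) \<bullet> u) has_derivative (\<lambda>h. hess (x + t *\<^sub>R v) (h *\<^sub>R v) \<bullet> u)) (at t)"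
    by (rule has_derivative_inner_left)
  moreover have "hess (x + t *\<^sub>R v) (h *\<^sub>R v) \<bullet> u = hess (x + t *\<^sub>R v) v \<bullet> u * h" for h
    using linear_scale[OF bounded_linear.linear[OF hess_bounded_linear[OF ray_in[OF assms]]]] by simp
  ultimately show ?thesis by (simp add: has_field_derivative_def)
qed

text \<open>With B the right-hand side, the derivative along the ray differs from its initial value
  by at most 2 B t, hence the function from its linearisation by at most B t^2.\<close>

lemma grad_taylor:
  assumes "x \<in> E" "v \<in> E"
  shows "\<bar>grad (x + v) \<bullet> u - grad x \<bullet> u - hess x v \<bullet> u\<bar> \<le> L / 2 * norm v ^ 2 * norm u"
    (is "_ \<le> ?B")
proof -
  let ?p = "\<lambda>t. grad (x + t *\<^sub>R v) \<bullet> u"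
  have h: "\<bar>hess (x + t *\<^sub>R v) v \<bullet> u - hess x v \<bullet> u\<bar> \<le> 2 * ?B * t" if "0 \<le> t" for t
    using hess_diff[of x "x + t *\<^sub>R v" v u] ray_in[OF assms] assms that
    by (simp add: inner_diff_left power2_eq_square mult_ac)
  have "?p 1 \<le> grad x \<bullet> u + hess x v \<bullet> u * 1 + ?B * 1\<^sup>2"
    by (rule le_of_deriv_le[where q = "\<lambda>t. grad x \<bullet> u + hess x v \<bullet> u * t + ?B * t\<^sup>2"
          and p' = "\<lambda>t. hess (x + t *\<^sub>R v) v \<bullet> u" and q' = "\<lambda>t. hess x v \<bullet> u + 2 * ?B * t"])
      (use grad_ray_deriv[OF assms] h in \<open>auto intro!: derivative_eq_intros simp: abs_le_iff algebra_simps\<close>)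
  moreover have "grad x \<bullet> u + hess x v \<bullet> u * 1 - ?B * 1\<^sup>2 \<le> ?p 1"
    by (rule le_of_deriv_le[where p = "\<lambda>t. grad x \<bullet> u + hess x v \<bullet> u * t - ?B * t\<^sup>2"
          and q' = "\<lambda>t. hess (x + t *\<^sub>R v) v \<bullet> u" and p' = "\<lambda>t. hess x v \<bullet> u - 2 * ?B * t"])
      (use grad_ray_deriv[OF assms] h in \<open>auto intro!: derivative_eq_intros simp: abs_le_iff algebra_simps\<close>)
  ultimately show ?thesis unfolding abs_le_iff by simp
qed

text \<open>The same comparison one order higher: \<open>grad_taylor\<close> bounds the error of the
  slope by 3 B t^2, which gives B t^3 for the value.\<close>

lemma f_taylor:
  assumes "x \<in> E" "v \<in> E"
  shows "\<bar>f (x + v) - f x - grad x \<bullet> v - v \<bullet> hess x v / 2\<bar> \<le> L / 6 * norm v ^ 3"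
    (is "_ \<le> ?B")
proof -
  let ?p = "\<lambda>t. f (x + t *\<^sub>R v)"
  have h: "\<bar>grad (x + t *\<^sub>R v) \<bullet> v - grad x \<bullet> v - v \<bullet> hess x v * t\<bar> \<le> 3 * ?B * t\<^sup>2" if "0 \<le> t" for t
  proof -
    have "hess x (t *\<^sub>R v) = t *\<^sub>R hess x v"
      using linear_scale[OF bounded_linear.linear[OF hess_bounded_linear[OF assms(1)]]] .
    then show ?thesis using grad_taylor[OF assms(1), of "t *\<^sub>R v" v] subspace_scale[OF subspace assms(2), of t]
      by (simp add: power_mult_distrib power2_eq_square power3_eq_cube inner_commute mult_ac)
  qed
  have upper: "grad (x + t *\<^sub>R v) \<bullet> v \<le> grad x \<bullet> v + (v \<bullet> hess x v) * t + 3 * ?B * t\<^sup>2"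
    and lower: "grad x \<bullet> v + (v \<bullet> hess x v) * t - 3 * ?B * t\<^sup>2 \<le> grad (x + t *\<^sub>R v) \<bullet> v"
    if "0 \<le> t" for t
    using h[OF that] by linarith+
  have "?p 1 \<le> f x + grad x \<bullet> v * 1 + (v \<bullet> hess x v) / 2 * 1\<^sup>2 + ?B * 1 ^ 3"
    by (rule le_of_deriv_le[where q = "\<lambda>t. f x + grad x \<bullet> v * t + (v \<bullet> hess x v) / 2 * t\<^sup>2 + ?B * t ^ 3"
          and p' = "\<lambda>t. grad (x + t *\<^sub>R v) \<bullet> v" and q' = "\<lambda>t. grad x \<bullet> v + (v \<bullet> hess x v) * t + 3 * ?B * t\<^sup>2"])
      (use f_ray_deriv[OF assms] upper in \<open>auto intro!: derivative_eq_intros\<close>)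
  moreover have "f x + grad x \<bullet> v * 1 + (v \<bullet> hess x v) / 2 * 1\<^sup>2 - ?B * 1 ^ 3 \<le> ?p 1"
    by (rule le_of_deriv_le[where p = "\<lambda>t. f x + grad x \<bullet> v * t + (v \<bullet> hess x v) / 2 * t\<^sup>2 - ?B * t ^ 3"
          and q' = "\<lambda>t. grad (x + t *\<^sub>R v) \<bullet> v" and p' = "\<lambda>t. grad x \<bullet> v + (v \<bullet> hess x v) * t - 3 * ?B * t\<^sup>2"])
      (use f_ray_deriv[OF assms] lower in \<open>auto intro!: derivative_eq_intros\<close>)
  ultimately show ?thesis unfolding abs_le_iff by simp
qed

lemma grad_at_minimizer:
  assumes "x \<in> E" "v \<in> E" "\<And>y. y \<in> E \<Longrightarrow> f x \<le> f y"
  shows "grad x \<bullet> v = 0"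
  using DERIV_local_min[OF f_ray_deriv[OF assms(1,2), of 0], of 1] assms(3) ray_in[OF assms(1,2)] by auto

text \<open>Two comparisons along the ray, from curvature to slope and from slope to value.\<close>

lemma strong_convexity:
  assumes "x \<in> E" "v \<in> E" and psd: "\<And>y. y \<in> E \<Longrightarrow> \<mu> * (norm v)\<^sup>2 \<le> v \<bullet> hess y v"
  shows "f x + grad x \<bullet> v + \<mu> / 2 * (norm v)\<^sup>2 \<le> f (x + v)"
proof -
  have g: "grad x \<bullet> v + \<mu> * (norm v)\<^sup>2 * t \<le> grad (x + t *\<^sub>R v) \<bullet> v" if "0 \<le> t" for t
    by (rule le_of_deriv_le[where p = "\<lambda>t. grad x \<bullet> v + \<mu> * (norm v)\<^sup>2 * t"
          and p' = "\<lambda>t. \<mu> * (norm v)\<^sup>2" and q' = "\<lambda>t. hess (x + t *\<^sub>R v) v \<bullet> v"])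
      (use grad_ray_deriv[OF assms(1,2)] psd ray_in[OF assms(1,2)] that in
        \<open>auto intro!: derivative_eq_intros simp: inner_commute\<close>)
  have "f x + grad x \<bullet> v * 1 + \<mu> / 2 * (norm v)\<^sup>2 * 1\<^sup>2 \<le> f (x + 1 *\<^sub>R v)"
    by (rule le_of_deriv_le[where p = "\<lambda>t. f x + grad x \<bullet> v * t + \<mu> / 2 * (norm v)\<^sup>2 * t\<^sup>2"
          and p' = "\<lambda>t. grad x \<bullet> v + \<mu> * (norm v)\<^sup>2 * t" and q' = "\<lambda>t. grad (x + t *\<^sub>R v) \<bullet> v"])
      (use f_ray_deriv[OF assms(1,2)] g in \<open>auto intro!: derivative_eq_intros\<close>)
  then show ?thesis by simp
qed

text \<open>Symmetry is a Schwarz-type statement: the second difference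
  \<open>f (x + u + v) - f (x + u) - f (x + v) + f x\<close> is symmetric in \<open>u\<close> and \<open>v\<close> and equals
  \<open>hess x u \<bullet> v\<close> up to a cubic error.\<close>

lemma hess_symmetric:
  assumes "x \<in> E" "u \<in> E" "v \<in> E"
  shows "u \<bullet> hess x v = v \<bullet> hess x u"
proof -
  define D where "D u v = f (x + u + v) - f (x + u) - f (x + v) + f x" for u v
  \<comment> \<open>The errors of \<open>f_taylor\<close> at \<open>x + u\<close> and at
    \<open>x\<close>, half the change of the Hessian between these points, and the error of
    \<open>grad_taylor\<close>.\<close>
  define C where "C u v = L / 3 * norm v ^ 3 + L / 2 * norm u * norm v ^ 2 + L / 2 * norm u ^ 2 * norm v" for u v :: 'a
  have D: "\<bar>D u v - hess x u \<bullet> v\<bar> \<le> C u v" if "u \<in> E" "v \<in> E" for u v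
  proof -
    have "x + u \<in> E" using assms(1) that subspace_add[OF subspace] by blast
    note f_taylor[OF this that(2)] f_taylor[OF assms(1) that(2)] grad_taylor[OF assms(1) that(1), of v]
      hess_diff[OF assms(1) this that(2), of v]
    then show ?thesis
      unfolding D_def C_def abs_le_iff inner_diff_left inner_commute[of "hess _ v"]
      by (simp add: power2_eq_square mult.assoc)
  qed
  \<comment> \<open>Scaling both vectors by \<open>s\<close> multiplies the Hessian terms by
    \<open>s^2\<close> and the error by \<open>s^3\<close>, so one factor \<open>s\<close>
    survives.\<close>
  have scaled: "\<bar>hess x u \<bullet> v - hess x v \<bullet> u\<bar> \<le> s * (C u v + C v u)" if "s > 0" for s
  proof -
    have su: "s *\<^sub>R u \<in> E" "s *\<^sub>R v \<in> E" using assms subspace_scale[OF subspace] by auto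
    have "D (s *\<^sub>R u) (s *\<^sub>R v) = D (s *\<^sub>R v) (s *\<^sub>R u)" by (simp add: D_def add_ac)
    then have "\<bar>hess x (s *\<^sub>R u) \<bullet> (s *\<^sub>R v) - hess x (s *\<^sub>R v) \<bullet> (s *\<^sub>R u)\<bar>
        \<le> C (s *\<^sub>R u) (s *\<^sub>R v) + C (s *\<^sub>R v) (s *\<^sub>R u)"
      using D[OF su] D[OF su(2,1)] by simp
    moreover have "C (s *\<^sub>R u) (s *\<^sub>R v) + C (s *\<^sub>R v) (s *\<^sub>R u) = s\<^sup>2 * (s * (C u v + C v u))"
      using that by (simp add: C_def power2_eq_square power3_eq_cube algebra_simps)
    moreover have "hess x (s *\<^sub>R u) \<bullet> (s *\<^sub>R v) - hess x (s *\<^sub>R v) \<bullet> (s *\<^sub>R u)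
        = s\<^sup>2 * (hess x u \<bullet> v - hess x v \<bullet> u)"
      using linear_scale[OF bounded_linear.linear[OF hess_bounded_linear[OF assms(1)]]]
      by (simp add: power2_eq_square algebra_simps)
    ultimately have "s\<^sup>2 * \<bar>hess x u \<bullet> v - hess x v \<bullet> u\<bar> \<le> s\<^sup>2 * (s * (C u v + C v u))"
      by (simp add: abs_mult)
    then show ?thesis using that by simp
  qed
  have "\<bar>hess x u \<bullet> v - hess x v \<bullet> u\<bar> \<le> 0 + e" if "e > 0" for e
  proof -
    \<comment> \<open>The added 1 keeps the denominator of the chosen \<open>s\<close>
      positive.\<close>
    have pos: "\<bar>C u v + C v u\<bar> + 1 > 0" by linarith
    have "\<bar>hess x u \<bullet> v - hess x v \<bullet> u\<bar> \<le> e / (\<bar>C u v + C v u\<bar> + 1) * (C u v + C v u)"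
      using pos that by (intro scaled) simp
    also have "\<dots> \<le> e / (\<bar>C u v + C v u\<bar> + 1) * (\<bar>C u v + C v u\<bar> + 1)"
      using pos that by (intro mult_left_mono) auto
    finally show ?thesis using pos by simp
  qed
  then have "\<bar>hess x u \<bullet> v - hess x v \<bullet> u\<bar> \<le> 0" by (rule field_le_epsilon)
  then show ?thesis by (simp add: inner_commute)
qed

end

section \<open>One step of the method\<close>

text \<open>After \<open>growth\<close> bounds \<open>R\<close>, the quadratic and cubic
  coefficients are at most \<open>a * \<delta>\<close> and \<open>y^2 * \<delta>\<close>. The chosen
  \<eta> lets each error consume at most a quarter of the gain \<open>\<eta> * \<delta>\<close>,
  which leaves half of it.\<close>

lemma contraction_of_interpolation_bound:
  fixes \<delta> \<delta>' :: real
  assumes nonneg: "\<delta> \<ge> 0" "\<mu> > 0" "R \<ge> 0" "\<kappa> \<ge> 0" "\<Lambda> \<ge> 0"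
    and growth: "\<mu> / 2 * R\<^sup>2 \<le> \<delta>"
    and bound: "\<And>\<eta>. 0 \<le> \<eta> \<Longrightarrow> \<eta> \<le> 1 \<Longrightarrow>
      \<delta>' \<le> (1 - \<eta>) * \<delta> + \<eta>\<^sup>2 * (\<kappa> / 2) * R\<^sup>2 + \<eta> ^ 3 * (\<Lambda> / 6) * R ^ 3"
  defines "y \<equiv> sqrt \<Lambda> / \<mu> powr (3 / 4) * \<delta> powr (1 / 4)"
  shows "\<delta>' \<le> (1 - 1 / (2 * (1 + 4 * (\<kappa> / \<mu>) + 2 * y))) * \<delta>"
proof -
  define a where "a = \<kappa> / \<mu>"
  define \<eta> where "\<eta> = 1 / (1 + 4 * a + 2 * y)"
  have a: "a \<ge> 0" and y: "y \<ge> 0" using nonneg by (auto simp: a_def y_def)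
  have \<eta>: "0 < \<eta>" "\<eta> \<le> 1" "\<eta> * a \<le> 1 / 4" "\<eta> * y \<le> 1 / 2"
    using a y by (auto simp: \<eta>_def divide_simps)
  have R2: "R\<^sup>2 \<le> 2 * \<delta> / \<mu>" using growth nonneg by (simp add: field_simps)
  have y2: "y\<^sup>2 = \<Lambda> * sqrt \<delta> / (\<mu> * sqrt \<mu>)"
  proof -
    have "(\<delta> powr (1 / 4))\<^sup>2 = sqrt \<delta>"
      by (cases "\<delta> = 0") (use nonneg in \<open>simp_all add: powr_powr powr_realpow[symmetric] powr_half_sqrt\<close>)
    moreover have "(\<mu> powr (3 / 4))\<^sup>2 = \<mu> powr (1 + 1 / 2)"
      using nonneg by (simp add: powr_powr powr_realpow[symmetric])
    then have "(\<mu> powr (3 / 4))\<^sup>2 = \<mu> * sqrt \<mu>"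
      using nonneg unfolding powr_add by (simp add: powr_half_sqrt)
    ultimately show ?thesis using nonneg by (simp add: y_def power_mult_distrib power_divide)
  qed
  have "sqrt (R\<^sup>2) \<le> sqrt (2 * \<delta> / \<mu>)" using R2 by (rule real_sqrt_le_mono)
  also have "\<dots> = sqrt 2 * (sqrt \<delta> / sqrt \<mu>)" by (simp add: real_sqrt_mult real_sqrt_divide)
  \<comment> \<open>Rounding sqrt 2 up to 2 is affordable: the cubic coefficient becomes 2/3, still
    below 1.\<close>
  also have "\<dots> \<le> 2 * (sqrt \<delta> / sqrt \<mu>)"
    using nonneg real_sqrt_le_mono[of 2 4] by (intro mult_right_mono) auto
  finally have "R \<le> 2 * (sqrt \<delta> / sqrt \<mu>)" using nonneg by simp
  then have "R\<^sup>2 * R \<le> (2 * \<delta> / \<mu>) * (2 * (sqrt \<delta> / sqrt \<mu>))"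
    using R2 nonneg by (intro mult_mono) auto
  then have "\<Lambda> / 6 * (R\<^sup>2 * R) \<le> \<Lambda> / 6 * ((2 * \<delta> / \<mu>) * (2 * (sqrt \<delta> / sqrt \<mu>)))"
    using nonneg by (intro mult_left_mono) auto
  also have "\<dots> = 2 / 3 * y\<^sup>2 * \<delta>" unfolding y2 by simp
  also have "\<dots> \<le> y\<^sup>2 * \<delta>" using nonneg by (intro mult_right_mono) auto
  finally have cubic: "\<Lambda> / 6 * R ^ 3 \<le> y\<^sup>2 * \<delta>" by (simp add: power2_eq_square power3_eq_cube mult.assoc)
  have "\<kappa> / 2 * R\<^sup>2 \<le> \<kappa> / 2 * (2 * \<delta> / \<mu>)" using R2 nonneg by (intro mult_left_mono) auto
  then have quadratic: "\<kappa> / 2 * R\<^sup>2 \<le> a * \<delta>" by (simp add: a_def)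
  have "\<eta>\<^sup>2 * (\<kappa> / 2 * R\<^sup>2) \<le> \<eta>\<^sup>2 * (a * \<delta>)" using quadratic by (rule mult_left_mono) simp
  also have "\<dots> = \<eta> * \<delta> * (\<eta> * a)" by (simp add: power2_eq_square)
  also have "\<dots> \<le> \<eta> * \<delta> * (1 / 4)" using \<eta> nonneg by (intro mult_left_mono) auto
  finally have 1: "\<eta>\<^sup>2 * (\<kappa> / 2 * R\<^sup>2) \<le> \<eta> * \<delta> / 4" by simp
  have "\<eta> ^ 3 * (\<Lambda> / 6 * R ^ 3) \<le> \<eta> ^ 3 * (y\<^sup>2 * \<delta>)" using cubic \<eta> by (intro mult_left_mono) auto
  also have "\<dots> = \<eta> * \<delta> * (\<eta> * y)\<^sup>2" by (simp add: power2_eq_square power3_eq_cube)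
  also have "\<dots> \<le> \<eta> * \<delta> * (1 / 2)\<^sup>2" using \<eta> nonneg y by (intro mult_left_mono power_mono) auto
  finally have 2: "\<eta> ^ 3 * (\<Lambda> / 6 * R ^ 3) \<le> \<eta> * \<delta> / 4" by (simp add: power2_eq_square)
  have "\<delta>' \<le> (1 - \<eta>) * \<delta> + \<eta>\<^sup>2 * (\<kappa> / 2 * R\<^sup>2) + \<eta> ^ 3 * (\<Lambda> / 6 * R ^ 3)"
    using bound[of \<eta>] \<eta> by (simp only: mult.assoc)
  also have "\<dots> \<le> (1 - \<eta> / 2) * \<delta>" using 1 2 by (simp add: algebra_simps)
  finally show ?thesis by (simp add: \<eta>_def a_def)
qed

text \<open>The potential \<open>2 A ln \<delta> + 16 c \<delta>\<^sup>1\<^sup>/\<^sup>4\<close> drops by at least 1 in every step: it is an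
  antiderivative of \<open>2 (A + 2 c \<delta>\<^sup>1\<^sup>/\<^sup>4) / \<delta>\<close>, the reciprocal of the guaranteed decrease.\<close>

lemma iteration_count_bound:
  fixes \<delta> :: "nat \<Rightarrow> real"
  assumes "A \<ge> 1" "c \<ge> 0" and pos: "\<And>i. i \<le> n \<Longrightarrow> \<delta> i > 0"
    and step: "\<And>i. i < n \<Longrightarrow> \<delta> (Suc i) \<le> (1 - 1 / (2 * (A + 2 * (c * \<delta> i powr (1 / 4))))) * \<delta> i"
  shows "real n \<le> 2 * A * ln (\<delta> 0 / \<delta> n) + 16 * c * (\<delta> 0 powr (1 / 4) - \<delta> n powr (1 / 4))"
  using pos step
proof (induction n)
  case (Suc n)
  define q where "q = \<delta> n powr (1 / 4)"
  \<comment> \<open>The guaranteed relative decrease; it is at most 1/2 because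
    \<open>A \<ge> 1\<close>.\<close>
  define h where "h = 1 / (2 * (A + 2 * (c * q)))"
  have pos: "\<delta> 0 > 0" "\<delta> n > 0" "\<delta> (Suc n) > 0" using Suc.prems(1) by auto
  have q: "c * q \<ge> 0" using assms by (simp add: q_def)
  have h: "0 < h" "h \<le> 1 / 2" "h * (2 * (A + 2 * (c * q))) = 1"
    using assms q by (auto simp: h_def divide_simps)
  have le: "\<delta> (Suc n) \<le> (1 - h) * \<delta> n" using Suc.prems(2)[of n] by (simp add: h_def q_def)
  then have "ln (\<delta> (Suc n)) \<le> ln ((1 - h) * \<delta> n)" using pos h by simp
  also have "\<dots> = ln (1 - h) + ln (\<delta> n)" using pos h by (simp add: ln_mult)
  also have "ln (1 - h) \<le> - h" using ln_le_minus_one[of "1 - h"] h by simp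
  finally have "h \<le> ln (\<delta> n / \<delta> (Suc n))" using pos by (simp add: ln_div)
  then have "2 * A * h \<le> 2 * A * ln (\<delta> n / \<delta> (Suc n))" using assms by (intro mult_left_mono) auto
  moreover have "\<delta> (Suc n) powr (1 / 4) \<le> (1 - h / 4) * q"
  proof -
    \<comment> \<open>Bernoulli's inequality prepares the fourth root: the root of the gap shrinks
      by the factor \<open>1 - h / 4\<close>.\<close>
    have "1 - h \<le> (1 - h / 4) ^ 4" using Bernoulli_inequality[of "- h / 4" 4] h by simp
    then have "\<delta> (Suc n) \<le> (1 - h / 4) ^ 4 * \<delta> n"
      using le pos by (meson less_imp_le mult_right_mono order_trans)
    then have "\<delta> (Suc n) powr (1 / 4) \<le> ((1 - h / 4) ^ 4 * \<delta> n) powr (1 / 4)"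
      using pos by (intro powr_mono2) auto
    also have "\<dots> = ((1 - h / 4) ^ 4) powr (1 / 4) * q" using pos h by (simp add: powr_mult q_def)
    also have "((1 - h / 4) ^ 4) powr (1 / 4) = ((1 - h / 4) powr real 4) powr (1 / 4)"
      using h by (subst powr_realpow) auto
    also have "\<dots> = 1 - h / 4" using h unfolding powr_powr by simp
    finally show ?thesis .
  qed
  then have "16 * c * (h / 4 * q) \<le> 16 * c * (q - \<delta> (Suc n) powr (1 / 4))"
    using assms by (intro mult_left_mono) (auto simp: algebra_simps)
  \<comment> \<open>By the choice of \<open>h\<close>, the guaranteed drops of the two parts of the
    potential add up to exactly 1.\<close>
  moreover have "1 = 2 * A * h + 16 * c * (h / 4 * q)" using h(3) by (simp add: algebra_simps)
  moreover have "real n \<le> 2 * A * ln (\<delta> 0 / \<delta> n) + 16 * c * (\<delta> 0 powr (1 / 4) - q)"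
    unfolding q_def using Suc by simp
  ultimately have "real n + 1 \<le> 2 * A * (ln (\<delta> 0 / \<delta> n) + ln (\<delta> n / \<delta> (Suc n)))
      + 16 * c * (\<delta> 0 powr (1 / 4) - \<delta> (Suc n) powr (1 / 4))"
    by (simp add: algebra_simps)
  then show ?case using pos by (simp add: ln_div)
qed simp

section \<open>Descent by the Krylov-restricted cubic model\<close>

context C2_lipschitz
begin

text \<open>Since \<open>L \<le> M\<close>, the cubic model majorises the change of
  \<open>f\<close>, and \<open>s\<close> does at least as well in the model as the competitor
  \<open>w\<close>.\<close>

lemma krylov_step_decrease:
  assumes "x \<in> E" "L \<le> M" "0 \<le> M"
    and s: "is_arg_min (cubic_model M (hess x) (grad x)) (\<lambda>s. s \<in> krylov m (hess x) (grad x)) s"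
    and w: "w \<in> krylov m (hess x) (grad x)"
  shows "x + s \<in> E" "f (x + s) \<le> f x + cubic_model M (hess x) (grad x) w"
proof -
  have "s \<in> E" using s krylov_subset[OF subspace hess_image grad_in] assms(1)
    by (auto simp: is_arg_min_def)
  then show "x + s \<in> E" using assms(1) subspace_add[OF subspace] by blast
  have "f (x + s) \<le> f x + grad x \<bullet> s + s \<bullet> hess x s / 2 + L / 6 * norm s ^ 3"
    using f_taylor[OF assms(1) \<open>s \<in> E\<close>] by linarith
  also have "\<dots> \<le> f x + cubic_model M (hess x) (grad x) s"
    using assms(2) by (simp add: cubic_model_def mult_right_mono)
  also have "\<dots> \<le> f x + cubic_model M (hess x) (grad x) w"
    using s w by (auto simp: is_arg_min_def not_less)
  finally show "f (x + s) \<le> f x + cubic_model M (hess x) (grad x) w" .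
qed

text \<open>The competitor is the localization of a fraction \<eta> of the segment towards
  \<open>y\<close>. Its model value exceeds that of the unrestricted step \<open>v\<close> only by
  the \<kappa> term, and convexity controls \<open>f (x + v)\<close>.\<close>

lemma krylov_step_interpolation:
  assumes convex: "convex_on E f" and x: "x \<in> E" "y \<in> E" and "grad x \<noteq> 0"
    and psd: "\<And>v. v \<in> E \<Longrightarrow> v \<bullet> hess x v \<ge> 0"
    and M: "L \<le> M" "0 \<le> M" and "m \<ge> 1"
    and s: "is_arg_min (cubic_model M (hess x) (grad x)) (\<lambda>s. s \<in> krylov m (hess x) (grad x)) s"
    and \<eta>: "0 \<le> \<eta>" "\<eta> \<le> 1"
  defines "\<kappa> \<equiv> (pi / 2)\<^sup>2 * krylov_rho m (hess x) (grad x) / (real m)\<^sup>2"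
  shows "f (x + s) - f y \<le> (1 - \<eta>) * (f x - f y) + \<eta>\<^sup>2 * (\<kappa> / 2) * (norm (y - x))\<^sup>2
    + \<eta> ^ 3 * ((L + M) / 6) * norm (y - x) ^ 3"
proof -
  define v where "v = \<eta> *\<^sub>R (y - x)"
  have v: "v \<in> E" "norm v = \<eta> * norm (y - x)"
    using x subspace_scale[OF subspace] subspace_diff[OF subspace] \<eta> by (auto simp: v_def)
  obtain w where w: "w \<in> krylov m (hess x) (grad x)" "norm w \<le> norm v" "grad x \<bullet> w = grad x \<bullet> v"
    "w \<bullet> hess x w \<le> v \<bullet> hess x v + \<kappa> * (norm v)\<^sup>2"
    unfolding \<kappa>_def
    using krylov_localization[OF hess_bounded_linear[OF x(1)] hess_image[OF x(1)] subspace
        grad_in[OF x(1)] \<open>grad x \<noteq> 0\<close> v(1) hess_symmetric[OF x(1)] psd \<open>m \<ge> 1\<close>]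
    by blast
  have "M / 6 * norm w ^ 3 \<le> M / 6 * norm v ^ 3"
    using w(2) M by (intro mult_left_mono power_mono) auto
  moreover have "1 / 2 * (w \<bullet> hess x w) \<le> 1 / 2 * (v \<bullet> hess x v + \<kappa> * (norm v)\<^sup>2)"
    using w(4) by simp
  ultimately have "f (x + s) \<le> f x + grad x \<bullet> v + 1 / 2 * (v \<bullet> hess x v + \<kappa> * (norm v)\<^sup>2) + M / 6 * norm v ^ 3"
    using krylov_step_decrease(2)[OF x(1) M s w(1)] w(3) unfolding cubic_model_def by linarith
  also have "\<dots> \<le> f (x + v) + \<kappa> / 2 * (norm v)\<^sup>2 + (L + M) / 6 * norm v ^ 3"
  proof -
    \<comment> \<open>The Taylor bound is used a second time, now from below; this is why
      \<open>L\<close> is added to \<open>M\<close>.\<close>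
    have "f x + grad x \<bullet> v + v \<bullet> hess x v / 2 - L / 6 * norm v ^ 3 \<le> f (x + v)"
      using f_taylor[OF x(1) v(1)] by linarith
    then show ?thesis by (simp add: algebra_simps add_divide_distrib)
  qed
  also have "f (x + v) \<le> (1 - \<eta>) * f x + \<eta> * f y"
  proof -
    have "x + v = (1 - \<eta>) *\<^sub>R x + \<eta> *\<^sub>R y" by (simp add: v_def algebra_simps)
    then show ?thesis using convex_onD[OF convex \<eta> x] by simp
  qed
  finally show ?thesis by (simp add: v(2) power_mult_distrib algebra_simps)
qed

end

section \<open>Iteration complexity\<close>

locale krylov_crn = C2_lipschitz E f grad hess L
  for E :: "'a::real_inner set" and f grad hess L +
  fixes \<mu> M :: real and m :: nat and x :: "nat \<Rightarrow> 'a" and y :: 'a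
  assumes convex: "convex_on E f" and level: "\<And>c. bounded {z \<in> E. f z \<le> c}"
    and mu: "\<mu> > 0" and strong: "\<And>z v. z \<in> E \<Longrightarrow> v \<in> E \<Longrightarrow> \<mu> * (norm v)\<^sup>2 \<le> v \<bullet> hess z v"
    and m: "m \<ge> 1" and M: "M > 0" "L \<le> M"
    and start: "x 0 \<in> E" and seq: "krylov_crn_seq m M grad hess x"
    and y: "y \<in> E" "\<And>z. z \<in> E \<Longrightarrow> f y \<le> f z"
begin

definition gap :: "nat \<Rightarrow> real"
  where "gap k = f (x k) - f y"

definition rho :: "nat \<Rightarrow> real"
  where "rho k = krylov_rho m (hess (x k)) (grad (x k))"

lemma iterate_in: "x k \<in> E"
proof (induction k)
  case (Suc k)
  have "0 \<in> krylov m (hess (x k)) (grad (x k))" by (simp add: krylov_def span_zero)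
  then show ?case
    using seq krylov_step_decrease(1)[OF Suc.IH M(2) less_imp_le[OF M(1)]]
    unfolding krylov_crn_seq_def by metis
qed (rule start)

text \<open>The zero step is admissible and has model value 0.\<close>

lemma iterate_decreasing: "f (x (Suc k)) \<le> f (x k)"
proof -
  have "0 \<in> krylov m (hess (x k)) (grad (x k))" by (simp add: krylov_def span_zero)
  then have "f (x (Suc k)) \<le> f (x k) + cubic_model M (hess (x k)) (grad (x k)) 0"
    using seq krylov_step_decrease(2)[OF iterate_in M(2) less_imp_le[OF M(1)]]
    unfolding krylov_crn_seq_def by metis
  then show ?thesis by (simp add: cubic_model_def)
qed

lemma iterate_le_start: "f (x k) \<le> f (x 0)"
  by (rule lift_Suc_antimono_le[of "\<lambda>k. f (x k)"]) (simp_all add: iterate_decreasing)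

lemma growth: "\<mu> / 2 * (norm (y - x k))\<^sup>2 \<le> gap k"
proof -
  have v: "x k - y \<in> E" using iterate_in y(1) subspace_diff[OF subspace] by blast
  have "f y + grad y \<bullet> (x k - y) + \<mu> / 2 * (norm (x k - y))\<^sup>2 \<le> f (y + (x k - y))"
    using y(1) v strong by (intro strong_convexity) auto
  then show ?thesis using grad_at_minimizer[OF y(1) v y(2)] by (simp add: gap_def norm_minus_commute)
qed

text \<open>By strong convexity a stationary point is a minimizer. The localization requires a
  nonzero start vector.\<close>

lemma grad_nonzero: "gap k > 0 \<Longrightarrow> grad (x k) \<noteq> 0"
proof
  assume "gap k > 0" "grad (x k) = 0"
  have v: "y - x k \<in> E" using iterate_in y(1) subspace_diff[OF subspace] by blast
  have "f (x k) + grad (x k) \<bullet> (y - x k) + \<mu> / 2 * (norm (y - x k))\<^sup>2 \<le> f (x k + (y - x k))"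
    using iterate_in v strong by (intro strong_convexity) auto
  moreover have "0 \<le> \<mu> / 2 * (norm (y - x k))\<^sup>2" using mu by simp
  ultimately show False using \<open>gap k > 0\<close> \<open>grad (x k) = 0\<close> by (simp add: gap_def)
qed

text \<open>A positive gap provides two distinct points of \<open>E\<close>, between which a
  negative Lipschitz constant is impossible. In dimension 0 the Lipschitz condition says nothing
  about the sign of \<open>L\<close>.\<close>

lemma L_nonneg:
  assumes "gap k > 0"
  shows "L \<ge> 0"
proof -
  have "x k \<noteq> y" using assms by (auto simp: gap_def)
  have "0 \<le> onorm_on E (\<lambda>v. hess (x k) v - hess y v)"
  proof (rule ccontr)
    assume neg: "\<not> ?thesis"
    have "bounded_linear (\<lambda>v. hess (x k) v - hess y v)"
      using hess_bounded_linear iterate_in y(1) by (intro bounded_linear_sub) auto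
    then have "0 \<le> onorm_on E (\<lambda>v. hess (x k) v - hess y v) * norm (x k - y)"
      using onorm_on_bound[of _ "x k - y" E] iterate_in y(1) subspace_diff[OF subspace] norm_ge_zero order_trans
      by blast
    with neg \<open>x k \<noteq> y\<close> show False by (simp add: zero_le_mult_iff)
  qed
  then have "0 \<le> L * norm (x k - y)" using lipschitz[OF iterate_in y(1)] order_trans by blast
  then show ?thesis using \<open>x k \<noteq> y\<close> by (simp add: zero_le_mult_iff)
qed

text \<open>Chosen so that \<open>c * gap k powr (1 / 4)\<close> is the quantity \<open>y\<close> of
  \<open>contraction_of_interpolation_bound\<close> for \<Lambda> = \<open>L + M\<close>.\<close>

definition c :: real
  where "c = sqrt (L + M) / \<mu> powr (3 / 4)"

lemma gap_step:
  assumes "gap k > 0" "rho k \<le> r"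
  shows "gap (Suc k) \<le> (1 - 1 / (2 * (1 + 16 * (r / (real m * \<mu>)) + 2 * (c * gap k powr (1 / 4))))) * gap k"
proof -
  obtain s where s: "is_arg_min (cubic_model M (hess (x k)) (grad (x k)))
      (\<lambda>s. s \<in> krylov m (hess (x k)) (grad (x k))) s" "x (Suc k) = x k + s"
    using seq unfolding krylov_crn_seq_def by blast
  define \<kappa> where "\<kappa> = (pi / 2)\<^sup>2 * rho k / (real m)\<^sup>2"
  have L: "L \<ge> 0" by (rule L_nonneg[OF assms(1)])
  have rho: "rho k \<ge> 0" by (simp add: rho_def krylov_rho_def)
  have psd: "v \<bullet> hess (x k) v \<ge> 0" if "v \<in> E" for v
    using strong[OF iterate_in that, of k] mu by (meson less_imp_le mult_nonneg_nonneg order_trans zero_le_power2)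
  have "gap (Suc k) \<le> (1 - \<eta>) * gap k + \<eta>\<^sup>2 * (\<kappa> / 2) * (norm (y - x k))\<^sup>2
      + \<eta> ^ 3 * ((L + M) / 6) * norm (y - x k) ^ 3" if "0 \<le> \<eta>" "\<eta> \<le> 1" for \<eta>
    unfolding gap_def s(2) \<kappa>_def rho_def
    by (rule krylov_step_interpolation[OF convex iterate_in y(1) grad_nonzero[OF assms(1)] psd M(2)
          less_imp_le[OF M(1)] m s(1) that])
  then have "gap (Suc k) \<le> (1 - 1 / (2 * (1 + 4 * (\<kappa> / \<mu>) + 2 * (c * gap k powr (1 / 4))))) * gap k"
    unfolding c_def using assms(1) mu M L rho growth[of k]
    by (intro contraction_of_interpolation_bound[where R = "norm (y - x k)"]) (auto simp: \<kappa>_def)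
  also have "\<dots> \<le> (1 - 1 / (2 * (1 + 16 * (r / (real m * \<mu>)) + 2 * (c * gap k powr (1 / 4))))) * gap k"
  proof -
    \<comment> \<open>The factor 16 is 4 times the bound 4 for (pi/2)^2; moreover 1/m^2 is relaxed
      to 1/m.\<close>
    have "(pi / 2)\<^sup>2 \<le> 2\<^sup>2" using pi_less_4 pi_gt_zero by (intro power_mono) auto
    moreover have "rho k / (real m)\<^sup>2 \<le> r / real m"
      using assms(2) rho m by (intro frac_le) (auto simp: power2_eq_square)
    ultimately have "(pi / 2)\<^sup>2 * (rho k / (real m)\<^sup>2) \<le> 2\<^sup>2 * (r / real m)"
      using rho by (intro mult_mono) auto
    then have "\<kappa> \<le> 4 * (r / real m)" by (simp add: \<kappa>_def)
    then have "\<kappa> / \<mu> \<le> 4 * (r / real m) / \<mu>" using mu by (intro divide_right_mono) auto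
    then have "4 * (\<kappa> / \<mu>) \<le> 16 * (r / (real m * \<mu>))" by simp
    moreover have "\<kappa> / \<mu> \<ge> 0" "c * gap k powr (1 / 4) \<ge> 0"
      using rho mu L M by (auto simp: \<kappa>_def c_def)
    ultimately show ?thesis using assms(1)
      by (intro mult_right_mono diff_left_mono divide_left_mono mult_pos_pos) auto
  qed
  finally show ?thesis .
qed

text \<open>Strictness comes from \<open>gap n > \<epsilon>\<close> and later lets the ceiling
  absorb one more step. The bound \<open>r\<close> stays free: a uniform bound gives termination,
  \<open>krylov_rho_max\<close> the final count.\<close>

lemma iterations_before_accuracy:
  assumes "\<epsilon> > 0" "r \<ge> 0" and above: "\<And>i. i \<le> n \<Longrightarrow> gap i > \<epsilon>" and rho: "\<And>i. i < n \<Longrightarrow> rho i \<le> r"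
  shows "real n < 32 * ((r / (real m * \<mu>) + 1) * ln (gap 0 / \<epsilon>) + c * gap 0 powr (1 / 4))"
proof -
  define A where "A = 1 + 16 * (r / (real m * \<mu>))"
  have pos: "gap i > 0" if "i \<le> n" for i using above[OF that] assms(1) by linarith
  have L: "L \<ge> 0" using L_nonneg pos by blast
  have c: "c \<ge> 0" using L M mu by (simp add: c_def)
  have r: "r / (real m * \<mu>) \<ge> 0" using assms(2) mu by simp
  then have A: "A \<ge> 1" by (simp add: A_def)
  have ln0: "ln (gap 0 / \<epsilon>) > 0" using above[of 0] assms(1) by simp
  have "real n \<le> 2 * A * ln (gap 0 / gap n) + 16 * c * (gap 0 powr (1 / 4) - gap n powr (1 / 4))"
    using A c pos gap_step rho by (intro iteration_count_bound) (auto simp: A_def)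
  also have "\<dots> < 2 * A * ln (gap 0 / \<epsilon>) + 16 * c * gap 0 powr (1 / 4)"
  proof (intro add_less_le_mono mult_strict_left_mono mult_left_mono)
    show "ln (gap 0 / gap n) < ln (gap 0 / \<epsilon>)"
      using pos[of 0] pos[of n] above[of n] assms(1) by (simp add: ln_div)
  qed (use A c in auto)
  also have "\<dots> \<le> 32 * ((r / (real m * \<mu>) + 1) * ln (gap 0 / \<epsilon>)) + 32 * (c * gap 0 powr (1 / 4))"
  proof (rule add_mono)
    \<comment> \<open>Here 32 arises: twice the 16 in \<open>A\<close>.\<close>
    have "2 * A * ln (gap 0 / \<epsilon>) \<le> (32 * (r / (real m * \<mu>) + 1)) * ln (gap 0 / \<epsilon>)"
      using ln0 r by (intro mult_right_mono) (auto simp: A_def)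
    then show "2 * A * ln (gap 0 / \<epsilon>) \<le> 32 * ((r / (real m * \<mu>) + 1) * ln (gap 0 / \<epsilon>))" by (simp only: mult.assoc)
  qed (use c in simp)
  finally show ?thesis by simp
qed

text \<open>The iterates stay in the bounded initial level set, so their Hessians differ from the
  first one by a bounded amount. A bound independent of \<open>k\<close> is required since
  \<open>krylov_rho_max\<close> grows with the number of iterates.\<close>

lemma rho_bounded: "\<exists>B\<ge>0. \<forall>k. rho k \<le> B"
proof -
  obtain D where D: "\<And>z. z \<in> E \<Longrightarrow> f z \<le> f (x 0) \<Longrightarrow> norm z \<le> D"
    using level[of "f (x 0)"] unfolding bounded_iff by auto
  obtain K where K: "\<And>v. norm (hess (x 0) v) \<le> norm v * K"
    using bounded_linear.bounded[OF hess_bounded_linear[OF start]] by blast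
  define B where "B = \<bar>L\<bar> * (2 * \<bar>D\<bar>) + \<bar>K\<bar>"
  have "rho k \<le> B" for k
    unfolding rho_def
  proof (rule krylov_rho_le[OF hess_bounded_linear[OF iterate_in] m])
    fix w assume w: "w \<in> krylov m (hess (x k)) (grad (x k))" "norm w = 1"
    then have "w \<in> E" using krylov_subset[OF subspace hess_image[OF iterate_in] grad_in[OF iterate_in]] by blast
    then have "norm (hess (x k) w - hess (x 0) w) \<le> L * norm (x k - x 0)"
      using norm_hess_diff[OF start iterate_in] w(2) by fastforce
    also have "\<dots> \<le> \<bar>L\<bar> * (2 * \<bar>D\<bar>)"
    proof (intro mult_mono)
      show "norm (x k - x 0) \<le> 2 * \<bar>D\<bar>"
        using D[OF iterate_in iterate_le_start, of k] D[OF start] norm_triangle_ineq4[of "x k" "x 0"] by linarith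
    qed auto
    finally show "norm (hess (x k) w) \<le> B"
      using K[of w] w(2) norm_triangle_sub[of "hess (x k) w" "hess (x 0) w"] by (simp add: B_def)
  qed (simp add: B_def)
  moreover have "B \<ge> 0" by (simp add: B_def)
  ultimately show ?thesis by blast
qed

text \<open>Otherwise every natural number would lie below one fixed real bound.\<close>

lemma accuracy_reached:
  assumes "\<epsilon> > 0"
  shows "\<exists>k. gap k \<le> \<epsilon>"
proof (rule ccontr)
  assume "\<not> ?thesis"
  then have above: "gap i > \<epsilon>" for i by (meson not_le)
  obtain B where B: "B \<ge> 0" "\<And>k. rho k \<le> B" using rho_bounded by blast
  have "real n < 32 * ((B / (real m * \<mu>) + 1) * ln (gap 0 / \<epsilon>) + c * gap 0 powr (1 / 4))" for n
    by (rule iterations_before_accuracy) (use assms above B in auto)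
  then show False by (meson reals_Archimedean2 less_asym)
qed

lemma iteration_complexity:
  assumes "\<epsilon> > 0"
  shows "\<exists>N. gap N \<le> \<epsilon> \<and> (\<forall>i<N. gap i > \<epsilon>) \<and>
    (N \<ge> 1 \<longrightarrow> int N \<le> \<lceil>32 * ((krylov_rho_max m grad hess x N / (real m * \<mu>) + 1) * ln (gap 0 / \<epsilon>)
      + sqrt (L + M) * gap 0 powr (1 / 4) / \<mu> powr (3 / 4))\<rceil>)"
proof -
  define N where "N = (LEAST k. gap k \<le> \<epsilon>)"
  have N: "gap N \<le> \<epsilon>" unfolding N_def by (rule LeastI_ex[OF accuracy_reached[OF assms]])
  have above: "gap i > \<epsilon>" if "i < N" for i 
    using not_less_Least[of i "\<lambda>k. gap k \<le> \<epsilon>"] that by (simp add: N_def not_le)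
  define r where "r = krylov_rho_max m grad hess x N"
  have "int N \<le> \<lceil>32 * ((r / (real m * \<mu>) + 1) * ln (gap 0 / \<epsilon>) + c * gap 0 powr (1 / 4))\<rceil>" if "N \<ge> 1"
  proof -
    have rho: "rho i \<le> r" if "i < N" for i
      unfolding r_def krylov_rho_max_def rho_def using that by (intro Max_ge) auto
    moreover have "0 \<le> rho 0" by (simp add: rho_def krylov_rho_def)
    ultimately have "r \<ge> 0" using that by (meson less_le_trans order_trans zero_less_one)
    \<comment> \<open>The iterates up to \<open>N - 1\<close> are all above the accuracy; a strict
      bound on \<open>N - 1\<close> turns into \<open>N\<close> below the ceiling.\<close>
    then have "real (N - 1) < 32 * ((r / (real m * \<mu>) + 1) * ln (gap 0 / \<epsilon>) + c * gap 0 powr (1 / 4))"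
      using assms above rho that by (intro iterations_before_accuracy) auto
    then have "int (N - 1) < \<lceil>32 * ((r / (real m * \<mu>) + 1) * ln (gap 0 / \<epsilon>) + c * gap 0 powr (1 / 4))\<rceil>"
      by (simp add: less_ceiling_iff)
    with that show ?thesis by linarith
  qed
  then show ?thesis using N above unfolding r_def c_def by (intro exI[of _ N]) simp
qed

end

section \<open>Specialisation to the coordinate spaces \<open>Rn d\<close>\<close>

lemma subspace_Rn: "subspace (Rn d)"
  by (auto simp: subspace_def Rn_def zero_fsvec.rep_eq plus_fsvec.rep_eq scaleR_fsvec.rep_eq)

theorem theorem4p5:
  shows "\<exists>C>0. \<forall>(d::nat) (f :: fsvec \<Rightarrow> real) (grad :: fsvec \<Rightarrow> fsvec) (hess :: fsvec \<Rightarrow> fsvec \<Rightarrow> fsvec)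
      (L2::real) (\<mu>::real) (m::nat) (M::real) (x :: nat \<Rightarrow> fsvec) (xs :: fsvec) (\<epsilon>::real).
    convex_on (Rn d) f \<and>
    C2_on (Rn d) f grad hess \<and>
    bdd_below (f ` Rn d) \<and>
    (\<forall>c. bounded {y \<in> Rn d. f y \<le> c}) \<and>
    (\<forall>y\<in>Rn d. \<forall>z\<in>Rn d. onorm_on (Rn d) (\<lambda>v. hess y v - hess z v) \<le> L2 * norm (y - z)) \<and>
    \<mu> > 0 \<and>
    (\<forall>y\<in>Rn d. \<forall>v\<in>Rn d. 0 \<le> v \<bullet> (hess y v - \<mu> *\<^sub>R v)) \<and>
    m \<ge> 1 \<and> M > 0 \<and> M \<ge> L2 \<and>
    x 0 \<in> Rn d \<and>
    krylov_crn_seq m M grad hess x \<and>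
    is_arg_min f (\<lambda>y. y \<in> Rn d) xs \<and>
    \<epsilon> > 0
    \<longrightarrow>
    (\<exists>N. f (x N) - f xs \<le> \<epsilon> \<and>
         (\<forall>i<N. f (x i) - f xs > \<epsilon>) \<and>
         (N \<ge> 1 \<longrightarrow>
           int N \<le> \<lceil>C * ((krylov_rho_max m grad hess x N / (real m * \<mu>) + 1)
                        * ln ((f (x 0) - f xs) / \<epsilon>)
                      + sqrt (L2 + M) * (f (x 0) - f xs) powr (1 / 4) / \<mu> powr (3 / 4))\<rceil>))"
proof (rule exI[of _ 32], intro conjI allI impI)
  show "(0::real) < 32" by simp
  fix d m :: nat and f :: "fsvec \<Rightarrow> real" and grad :: "fsvec \<Rightarrow> fsvec" and hess :: "fsvec \<Rightarrow> fsvec \<Rightarrow> fsvec"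
    and L2 \<mu> M \<epsilon> :: real and x :: "nat \<Rightarrow> fsvec" and xs :: fsvec
  assume H: "convex_on (Rn d) f \<and>
    C2_on (Rn d) f grad hess \<and>
    bdd_below (f ` Rn d) \<and>
    (\<forall>c. bounded {y \<in> Rn d. f y \<le> c}) \<and>
    (\<forall>y\<in>Rn d. \<forall>z\<in>Rn d. onorm_on (Rn d) (\<lambda>v. hess y v - hess z v) \<le> L2 * norm (y - z)) \<and>
    \<mu> > 0 \<and>
    (\<forall>y\<in>Rn d. \<forall>v\<in>Rn d. 0 \<le> v \<bullet> (hess y v - \<mu> *\<^sub>R v)) \<and>
    m \<ge> 1 \<and> M > 0 \<and> M \<ge> L2 \<and>
    x 0 \<in> Rn d \<and>
    krylov_crn_seq m M grad hess x \<and>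
    is_arg_min f (\<lambda>y. y \<in> Rn d) xs \<and>
    \<epsilon> > 0"
  \<comment> \<open>The matrix inequality for the Hessian becomes the quadratic form bound
    \<open>strong\<close>; the constant 32 is the same for every \<open>d\<close>.\<close>
  interpret krylov_crn "Rn d" f grad hess L2 \<mu> M m x xs
    using H by unfold_locales
      (auto simp: subspace_Rn is_arg_min_def not_less inner_diff_right power2_norm_eq_inner)
  have "\<epsilon> > 0" using H by blast
  from iteration_complexity[OF this]
  show "\<exists>N. f (x N) - f xs \<le> \<epsilon> \<and>
         (\<forall>i<N. f (x i) - f xs > \<epsilon>) \<and>
         (N \<ge> 1 \<longrightarrow>
           int N \<le> \<lceil>32 * ((krylov_rho_max m grad hess x N / (real m * \<mu>) + 1)
                        * ln ((f (x 0) - f xs) / \<epsilon>)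
                      + sqrt (L2 + M) * (f (x 0) - f xs) powr (1 / 4) / \<mu> powr (3 / 4))\<rceil>)"
    unfolding gap_def .
qed

end
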